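(* For every $d\in\mathbb N$, with $D_d=\{x\in\mathbb R^d:\sum_j|x_j|\le1\}$ and $\mathfrak C^{(d)}=\bigcup_n\{X\in(M_n)^d_{sa}:\|X_i\|\le1\text{ for all }i\}$, $$\mathfrak C^{(d)}=\mathcal W^{\max}([-1,1]^d)\subseteq d\,\mathcal W^{\min}(D_d).$$ In particular, for every matrix convex set $\mathcal S\subseteq\bigcup_n(M_n)^d_{sa}$ we have $$D_d\subseteq\mathcal S_1\ \Longrightarrow\ \mathfrak C^{(d)}\subseteq d\,\mathcal S.$$
   Context: $(M_n)^d_{sa}$ is the set of $d$-tuples of self-adjoint $n\times n$ complex matrices. A set $\mathcal S=\bigcup_n\mathcal S_n$ with $\mathcal S_n\subseteq(M_n)^d_{sa}$ is matrix convex if it is closed under direct sums and under unital completely positive maps (if $X\in\mathcal S_n$ and $\phi:M_n\to M_k$ is UCP then $(\phi(X_1),\dots,\phi(X_d))\in\mathcal S_k$); $\mathcal S_1\subseteq\mathbb R^d$. For a closed convex $K\subseteq\mathbb R^d$: $\mathcal W^{\min}(K)=\bigcup_n\mathcal W^{\min}_n(K)$, where $\mathcal W^{\min}_n(K)$ is the set of $X\in(M_n)^d_{sa}$ for which there are a tuple $N$ of commuting normal operators on a Hilbert space $L$ with joint spectrum $\sigma(N)\subseteq K$ and an isometry $V:\mathbb C^n\to L$ with $X_i=V^*N_iV$ for all $i$; and $\mathcal W^{\max}(K)=\bigcup_n\mathcal W^{\max}_n(K)$, where $\mathcal W^{\max}_n(K)$ is the set of $X\in(M_n)^d_{sa}$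 such that $\sum_i\alpha_iX_i\le aI_n$ whenever $\alpha\in\mathbb R^d$, $a\in\mathbb R$ satisfy $\sum_i\alpha_ix_i\le a$ for all $x\in K$. $c\,\mathcal S=\{cX:X\in\mathcal S\}$; inclusion means inclusion at every level $n$. *)

theory Defs
  imports
    "HOL-Analysis.Analysis"
    "HOL-Library.FuncSet"
    "Jordan_Normal_Form.Schur_Decomposition"
begin

no_notation vec_index (infixl \<open>$\<close> 100)

section \<open>Complex Hilbert spaces and bounded operators\<close>

text \<open>
  Hilbert spaces are carrier-based, so that one can quantify over them inside a formula.
  The record extends the HOL-Algebra module record; its ring fields \<open>mult\<close> and \<open>one\<close> play no
  role. The scalar ring \<open>class_ring\<close> is the field of complex numbers.
\<close>

record 'h hspace = "(complex, 'h) module" +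
  ip :: "'h \<Rightarrow> 'h \<Rightarrow> complex"

definition hnorm :: "'h hspace \<Rightarrow> 'h \<Rightarrow> real" where
  "hnorm H x = sqrt (Re (ip H x x))"

locale hilbert_space = vectorspace "class_ring :: complex ring" H
  for H :: "'h hspace" (structure) +
  assumes ip_commute: "\<And>x y. x \<in> carrier H \<Longrightarrow> y \<in> carrier H \<Longrightarrow> ip H y x = cnj (ip H x y)"
    and ip_add_left: "\<And>x y z. x \<in> carrier H \<Longrightarrow> y \<in> carrier H \<Longrightarrow> z \<in> carrier H \<Longrightarrow>
          ip H (x \<oplus> y) z = ip H x z + ip H y z"
    and ip_smult_left: "\<And>c x y. x \<in> carrier H \<Longrightarrow> y \<in> carrier H \<Longrightarrow>
          ip H (c \<odot> x) y = c * ip H x y"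
    and ip_pos: "\<And>x. x \<in> carrier H \<Longrightarrow> x \<noteq> \<zero> \<Longrightarrow> 0 < Re (ip H x x)"
    and complete: "\<And>s :: nat \<Rightarrow> 'h. (\<And>n. s n \<in> carrier H) \<Longrightarrow>
          (\<And>e. 0 < e \<Longrightarrow> \<exists>M. \<forall>m\<ge>M. \<forall>n\<ge>M. hnorm H (s m \<ominus> s n) < e) \<Longrightarrow>
          \<exists>x\<in>carrier H. (\<lambda>n. hnorm H (s n \<ominus> x)) \<longlonglongrightarrow> 0"

text \<open>
  Operators are extensional functions on the carrier, so that equality of operators is equality
  of HOL functions.
\<close>

definition linear_ops :: "'h hspace \<Rightarrow> 'k hspace \<Rightarrow> ('h \<Rightarrow> 'k) set" where
  "linear_ops H K = {T \<in> carrier H \<rightarrow>\<^sub>E carrier K.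
     (\<forall>x\<in>carrier H. \<forall>y\<in>carrier H. T (x \<oplus>\<^bsub>H\<^esub> y) = T x \<oplus>\<^bsub>K\<^esub> T y) \<and>
     (\<forall>c. \<forall>x\<in>carrier H. T (c \<odot>\<^bsub>H\<^esub> x) = c \<odot>\<^bsub>K\<^esub> T x)}"

definition bounded_ops :: "'h hspace \<Rightarrow> 'k hspace \<Rightarrow> ('h \<Rightarrow> 'k) set" where
  "bounded_ops H K = {T \<in> linear_ops H K.
     \<exists>c. \<forall>x\<in>carrier H. hnorm K (T x) \<le> c * hnorm H x}"

definition opnorm :: "'h hspace \<Rightarrow> 'k hspace \<Rightarrow> ('h \<Rightarrow> 'k) \<Rightarrow> real" where
  "opnorm H K T = Sup {hnorm K (T x) | x. x \<in> carrier H \<and> hnorm H x \<le> 1}"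

definition isometry_ops :: "'h hspace \<Rightarrow> 'k hspace \<Rightarrow> ('h \<Rightarrow> 'k) set" where
  "isometry_ops H K = {V \<in> linear_ops H K. \<forall>x\<in>carrier H. hnorm K (V x) = hnorm H x}"

definition adj :: "'h hspace \<Rightarrow> 'k hspace \<Rightarrow> ('h \<Rightarrow> 'k) \<Rightarrow> 'k \<Rightarrow> 'h" where
  "adj H K T = (\<lambda>y\<in>carrier K.
     THE z. z \<in> carrier H \<and> (\<forall>x\<in>carrier H. ip K (T x) y = ip H x z))"

definition op_id :: "'h hspace \<Rightarrow> 'h \<Rightarrow> 'h" where
  "op_id H = (\<lambda>x\<in>carrier H. x)"

definition op_add :: "'h hspace \<Rightarrow> ('h \<Rightarrow> 'h) \<Rightarrow> ('h \<Rightarrow> 'h) \<Rightarrow> 'h \<Rightarrow> 'h" where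
  "op_add H S T = (\<lambda>x\<in>carrier H. S x \<oplus>\<^bsub>H\<^esub> T x)"

definition op_smult :: "'h hspace \<Rightarrow> complex \<Rightarrow> ('h \<Rightarrow> 'h) \<Rightarrow> 'h \<Rightarrow> 'h" where
  "op_smult H c T = (\<lambda>x\<in>carrier H. c \<odot>\<^bsub>H\<^esub> T x)"

definition op_diff :: "'h hspace \<Rightarrow> ('h \<Rightarrow> 'h) \<Rightarrow> ('h \<Rightarrow> 'h) \<Rightarrow> 'h \<Rightarrow> 'h" where
  "op_diff H S T = (\<lambda>x\<in>carrier H. S x \<ominus>\<^bsub>H\<^esub> T x)"

definition op_comp :: "'h hspace \<Rightarrow> ('k \<Rightarrow> 'l) \<Rightarrow> ('h \<Rightarrow> 'k) \<Rightarrow> 'h \<Rightarrow> 'l" where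
  "op_comp H S T = compose (carrier H) S T"

section \<open>Joint spectrum of commuting normal operators\<close>

definition unital_cstar_subalgebra :: "'h hspace \<Rightarrow> ('h \<Rightarrow> 'h) set \<Rightarrow> bool" where
  "unital_cstar_subalgebra H \<A> \<longleftrightarrow>
     \<A> \<subseteq> bounded_ops H H \<and>
     op_id H \<in> \<A> \<and>
     (\<forall>S\<in>\<A>. \<forall>T\<in>\<A>. op_add H S T \<in> \<A> \<and> op_comp H S T \<in> \<A>) \<and>
     (\<forall>c. \<forall>T\<in>\<A>. op_smult H c T \<in> \<A>) \<and>
     (\<forall>T\<in>\<A>. adj H H T \<in> \<A>) \<and>
     (\<forall>S T. (\<forall>n::nat. S n \<in> \<A>) \<and> T \<in> bounded_ops H H \<and>
        (\<lambda>n. opnorm H H (op_diff H (S n) T)) \<longlonglongrightarrow> 0 \<longrightarrow> T \<in> \<A>)"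

definition cstar_generated :: "'h hspace \<Rightarrow> ('h \<Rightarrow> 'h) set \<Rightarrow> ('h \<Rightarrow> 'h) set" where
  "cstar_generated H G = \<Inter>{\<A>. unital_cstar_subalgebra H \<A> \<and> G \<subseteq> \<A>}"

definition character_on :: "'h hspace \<Rightarrow> ('h \<Rightarrow> 'h) set \<Rightarrow> (('h \<Rightarrow> 'h) \<Rightarrow> complex) \<Rightarrow> bool" where
  "character_on H \<A> f \<longleftrightarrow>
     (\<exists>T\<in>\<A>. f T \<noteq> 0) \<and>
     (\<forall>S\<in>\<A>. \<forall>T\<in>\<A>. f (op_add H S T) = f S + f T \<and> f (op_comp H S T) = f S * f T) \<and>
     (\<forall>c. \<forall>T\<in>\<A>. f (op_smult H c T) = c * f T)"

text \<open>
  The joint spectrum of a commuting normal tuple, by Gelfand theory: the image of the character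
  space of the unital C*-algebra generated by the tuple, as a subset of complex d-space.
\<close>

definition joint_spectrum ::
    "'h hspace \<Rightarrow> ('d::finite \<Rightarrow> 'h \<Rightarrow> 'h) \<Rightarrow> (complex^'d) set" where
  "joint_spectrum H N = {(\<chi> i. f (N i)) | f. character_on H (cstar_generated H (range N)) f}"

definition commuting_normal :: "'h hspace \<Rightarrow> ('d::finite \<Rightarrow> 'h \<Rightarrow> 'h) \<Rightarrow> bool" where
  "commuting_normal H N \<longleftrightarrow>
     (\<forall>i. N i \<in> bounded_ops H H) \<and>
     (\<forall>i. op_comp H (adj H H (N i)) (N i) = op_comp H (N i) (adj H H (N i))) \<and>
     (\<forall>i j. op_comp H (N i) (N j) = op_comp H (N j) (N i))"

section \<open>Matrices and tuples of matrices\<close>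

definition Cn :: "nat \<Rightarrow> complex vec hspace" where
  "Cn n = \<lparr>carrier = carrier_vec n, mult = undefined, one = undefined,
           zero = 0\<^sub>v n, add = (+), smult = (\<cdot>\<^sub>v), ip = (\<bullet>c)\<rparr>"

definition mat_op :: "nat \<Rightarrow> complex mat \<Rightarrow> complex vec \<Rightarrow> complex vec" where
  "mat_op n A = (\<lambda>v\<in>carrier_vec n. A *\<^sub>v v)"

definition psd :: "nat \<Rightarrow> complex mat \<Rightarrow> bool" where
  "psd n A \<longleftrightarrow> A \<in> carrier_mat n n \<and> mat_adjoint A = A \<and>
     (\<forall>v\<in>carrier_vec n. 0 \<le> Re ((A *\<^sub>v v) \<bullet>c v))"

text \<open>
  A d-tuple is a function on a finite index type \<open>'d\<close> with \<open>CARD('d)\<close> elements. A graded set of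
  tuples is the union of its levels, all of size at least 1; a tuple determines its level.
\<close>

definition sa_tuples :: "nat \<Rightarrow> ('d::finite \<Rightarrow> complex mat) set" where
  "sa_tuples n = {X. \<forall>i. X i \<in> carrier_mat n n \<and> mat_adjoint (X i) = X i}"

definition scale_tuples :: "real \<Rightarrow> ('d::finite \<Rightarrow> complex mat) set \<Rightarrow> ('d \<Rightarrow> complex mat) set" where
  "scale_tuples c \<S> = (\<lambda>X i. complex_of_real c \<cdot>\<^sub>m X i) ` \<S>"

text \<open>The first level, with real 1 by 1 matrices identified with real numbers.\<close>

definition level_one :: "('d::finite \<Rightarrow> complex mat) set \<Rightarrow> (real^'d) set" where
  "level_one \<S> = {x. (\<lambda>i. mat 1 1 (\<lambda>_. complex_of_real (x $ i))) \<in> \<S>}"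

section \<open>Unital completely positive maps and matrix convex sets\<close>

text \<open>
  \<open>amplify m n k \<phi>\<close> applies \<phi>, a map from n by n to k by k matrices, to each n by n block of an
  m by m block matrix.
\<close>

definition amplify ::
    "nat \<Rightarrow> nat \<Rightarrow> nat \<Rightarrow> (complex mat \<Rightarrow> complex mat) \<Rightarrow> complex mat \<Rightarrow> complex mat" where
  "amplify m n k \<phi> A = mat (m * k) (m * k) (\<lambda>(i, j).
     \<phi> (mat n n (\<lambda>(a, b). A $$ ((i div k) * n + a, (j div k) * n + b))) $$ (i mod k, j mod k))"

definition ucp :: "nat \<Rightarrow> nat \<Rightarrow> (complex mat \<Rightarrow> complex mat) \<Rightarrow> bool" where
  "ucp n k \<phi> \<longleftrightarrow>
     \<phi> \<in> carrier_mat n n \<rightarrow> carrier_mat k k \<and>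
     (\<forall>A\<in>carrier_mat n n. \<forall>B\<in>carrier_mat n n. \<phi> (A + B) = \<phi> A + \<phi> B) \<and>
     (\<forall>c. \<forall>A\<in>carrier_mat n n. \<phi> (c \<cdot>\<^sub>m A) = c \<cdot>\<^sub>m \<phi> A) \<and>
     \<phi> (1\<^sub>m n) = 1\<^sub>m k \<and>
     (\<forall>m A. psd (m * n) A \<longrightarrow> psd (m * k) (amplify m n k \<phi> A))"

definition matrix_convex :: "('d::finite \<Rightarrow> complex mat) set \<Rightarrow> bool" where
  "matrix_convex \<S> \<longleftrightarrow>
     \<S> \<subseteq> (\<Union>n\<in>{1..}. sa_tuples n) \<and>
     (\<forall>X\<in>\<S>. \<forall>Y\<in>\<S>. (\<lambda>i. diag_block_mat [X i, Y i]) \<in> \<S>) \<and>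
     (\<forall>n\<ge>1. \<forall>k\<ge>1. \<forall>\<phi>. \<forall>X\<in>\<S> \<inter> sa_tuples n. ucp n k \<phi> \<longrightarrow> (\<lambda>i. \<phi> (X i)) \<in> \<S>)"

section \<open>The minimal and maximal matrix convex sets over a convex set\<close>

text \<open>
  HOL cannot quantify over types inside a formula, so the Hilbert space \<open>H\<close> of the dilation is
  any Hilbert space whose carrier is a set of functions from \<open>nat\<close> to \<open>complex\<close>, with arbitrary
  operations. Up to unitary equivalence this covers every separable Hilbert space, which loses
  nothing: a dilation on an arbitrary Hilbert space can be cut down to the smallest reducing
  subspace containing the range of the isometry, which is separable, and this does not enlarge
  the joint spectrum.
\<close>

definition Wmin_level :: "(real^'d::finite) set \<Rightarrow> nat \<Rightarrow> ('d \<Rightarrow> complex mat) set" where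
  "Wmin_level K n = {X \<in> sa_tuples n.
     \<exists>(H :: (nat \<Rightarrow> complex) hspace) N V.
       hilbert_space H \<and> commuting_normal H N \<and>
       joint_spectrum H N \<subseteq> (\<lambda>x. \<chi> i. complex_of_real (x $ i)) ` K \<and>
       V \<in> isometry_ops (Cn n) H \<and>
       (\<forall>i. mat_op n (X i) = op_comp (Cn n) (adj (Cn n) H V) (op_comp (Cn n) (N i) V))}"

definition Wmin :: "(real^'d::finite) set \<Rightarrow> ('d \<Rightarrow> complex mat) set" where
  "Wmin K = (\<Union>n\<in>{1..}. Wmin_level K n)"

definition lin_comb :: "nat \<Rightarrow> real^'d::finite \<Rightarrow> ('d \<Rightarrow> complex mat) \<Rightarrow> complex mat" where
  "lin_comb n \<alpha> X = mat n n (\<lambda>(p, q). \<Sum>i\<in>UNIV. complex_of_real (\<alpha> $ i) * X i $$ (p, q))"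

definition Wmax_level :: "(real^'d::finite) set \<Rightarrow> nat \<Rightarrow> ('d \<Rightarrow> complex mat) set" where
  "Wmax_level K n = {X \<in> sa_tuples n.
     \<forall>\<alpha> a. (\<forall>x\<in>K. (\<Sum>i\<in>UNIV. \<alpha> $ i * x $ i) \<le> a) \<longrightarrow>
       psd n (complex_of_real a \<cdot>\<^sub>m 1\<^sub>m n - lin_comb n \<alpha> X)}"

definition Wmax :: "(real^'d::finite) set \<Rightarrow> ('d \<Rightarrow> complex mat) set" where
  "Wmax K = (\<Union>n\<in>{1..}. Wmax_level K n)"

section \<open>The cube, the diamond and the matrix cube\<close>

definition cube :: "(real^'d::finite) set" where
  "cube = {x. \<forall>i. x $ i \<in> {-1..1}}"

definition diamond :: "(real^'d::finite) set" where
  "diamond = {x. (\<Sum>j\<in>UNIV. \<bar>x $ j\<bar>) \<le> 1}"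

definition matrix_cube :: "('d::finite \<Rightarrow> complex mat) set" where
  "matrix_cube = (\<Union>n\<in>{1..}. {X \<in> sa_tuples n. \<forall>i. opnorm (Cn n) (Cn n) (mat_op n (X i)) \<le> 1})"

end

theory Submission
  imports Defs "Jordan_Normal_Form.Spectral_Radius"
begin

text \<open>
  Let \<open>X\<close> be a tuple of self-adjoint contractions and diagonalize each \<open>X\<^sub>i = U\<^sub>i diag(l\<^sub>i) U\<^sub>i\<^sup>*\<close>
  separately. With \<open>w\<close> the isometry that stacks the \<open>U\<^sub>i\<^sup>*\<close> divided by \<open>\<surd>d\<close>, the tuple \<open>X / d\<close> is the
  compression by \<open>w\<close> of the commuting tuple \<open>N\<close> of diagonal matrices on \<open>d\<close> blocks of size \<open>n\<close> in which
  \<open>N\<^sub>i\<close> is \<open>diag(l\<^sub>i)\<close> on block \<open>i\<close> and zero elsewhere. The joint eigenvalues of \<open>N\<close> are multiples of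
  unit vectors by numbers in \<open>[-1, 1]\<close>, so they lie in the diamond. Hence \<open>X / d\<close> is in
  the minimal set over the diamond, and it is a compression of a direct sum of points of the
  diamond, hence in every matrix convex set whose first level contains the diamond.
\<close>

section \<open>Unitary diagonalization of Hermitian matrices\<close>

text \<open>The \<open>X i\<close> need not commute, so no single eigenbasis serves them all. Giving
  each its own block makes the dilating operators commute trivially. The constant is the price: the
  \<open>d\<close> stacked unitaries contribute \<open>d\<close> copies of the identity, so an
  isometry requires the factor 1/sqrt d, and since only block \<open>i\<close> contributes to
  coordinate \<open>i\<close>, the compression is \<open>X i\<close> divided by \<open>d\<close>.

  The equality with the maximal set rests on the support function of the cube being the l1 norm: the
  half-spaces with normals +e_i and -e_i imply all others, which leaves -I <= X_i <= I, and for
  self-adjoint matrices this is the norm bound.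

  The claim about matrix convex sets is not deduced from the inclusion into the minimal set, where a
  dilation may live on an infinite-dimensional space. Both claims are read off the same finite data:
  an array \<open>w\<close> with orthonormal columns and points \<open>x p\<close> of the
  diamond.\<close>

lemma mat_adjoint_carrier [simp]:
  "A \<in> carrier_mat n m \<Longrightarrow> mat_adjoint A \<in> carrier_mat m n"
  by (auto simp: mat_adjoint_def mat_of_rows_def)

lemma mat_adjoint_index [simp]:
  assumes "i < dim_col A" "j < dim_row A"
  shows "mat_adjoint A $$ (i, j) = conjugate (A $$ (j, i))"
  using assms by (simp add: mat_adjoint_def mat_of_rows_def)

lemma mat_adjoint_dim [simp]:
  "dim_row (mat_adjoint A) = dim_col A" "dim_col (mat_adjoint A) = dim_row A"
  by (auto simp: mat_adjoint_def mat_of_rows_def)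

lemma mat_adjoint_mat_adjoint [simp]: "mat_adjoint (mat_adjoint A) = A"
  by (rule eq_matI) auto

lemma mat_adjoint_mult:
  assumes "A \<in> carrier_mat n m" "B \<in> carrier_mat m k"
  shows "mat_adjoint (A * B) = mat_adjoint B * mat_adjoint A"
proof (rule eq_matI)
  fix i j assume "i < dim_row (mat_adjoint B * mat_adjoint A)" "j < dim_col (mat_adjoint B * mat_adjoint A)"
  then have "i < k" "j < n" using assms by auto
  then show "mat_adjoint (A * B) $$ (i, j) = (mat_adjoint B * mat_adjoint A) $$ (i, j)"
    using assms by (auto simp: scalar_prod_def sum_conjugate conjugate_dist_mul mult.commute intro!: sum.cong)
qed (use assms in auto)

lemma hermitian_iff:
  assumes "A \<in> carrier_mat n n"
  shows "mat_adjoint A = A \<longleftrightarrow> (\<forall>i<n. \<forall>j<n. A $$ (i, j) = cnj (A $$ (j, i)))"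
proof
  assume *: "mat_adjoint A = A"
  show "\<forall>i<n. \<forall>j<n. A $$ (i, j) = cnj (A $$ (j, i))"
  proof (intro allI impI)
    fix i j assume "i < n" "j < n"
    then have "mat_adjoint A $$ (i, j) = cnj (A $$ (j, i))" using assms by simp
    then show "A $$ (i, j) = cnj (A $$ (j, i))" using * by simp
  qed
next
  assume *: "\<forall>i<n. \<forall>j<n. A $$ (i, j) = cnj (A $$ (j, i))"
  show "mat_adjoint A = A"
  proof (rule eq_matI)
    fix i j assume "i < dim_row A" "j < dim_col A"
    then have "i < n" "j < n" using assms by auto
    then show "mat_adjoint A $$ (i, j) = A $$ (i, j)"
      using *[rule_format, of i j] assms by simp
  qed (use assms in auto)
qed

text \<open>Supplies the unitary change of basis that puts a given eigenvector first. Gram-Schmidt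
  keeps the head of the basis, so column 0 stays on the line of \<open>v\<close>.\<close>

lemma orthonormal_completion:
  fixes v :: "complex vec"
  assumes v: "v \<in> carrier_vec n" "v \<noteq> 0\<^sub>v n"
  obtains W c where "W \<in> carrier_mat n n" "mat_adjoint W * W = 1\<^sub>m n" "Matrix.col W 0 = c \<cdot>\<^sub>v v"
proof -
  interpret cof_vec_space n "TYPE(complex)" .
  from basis_completion[OF v]
  have b: "distinct (basis_completion v)" "\<not> lin_dep (set (basis_completion v))"
    "set (basis_completion v) \<subseteq> carrier_vec n" "hd (basis_completion v) = v"
    "length (basis_completion v) = n" by auto
  define ws where "ws = gram_schmidt n (basis_completion v)"
  from gram_schmidt_result[OF b(3,1,2) ws_def] b(5)
  have ws: "set ws \<subseteq> carrier_vec n" "corthogonal ws" "length ws = n" by auto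
  have n: "n > 0" using v by (cases n) auto
  then obtain vs where "basis_completion v = v # vs"
    using b(4,5) by (cases "basis_completion v") auto
  then have "hd ws = v" unfolding ws_def using gram_schmidt_hd[OF v(1)] by simp
  then have ws0: "ws ! 0 = v" using ws(3) n by (subst hd_conv_nth[symmetric]) auto
  \<comment> \<open>Gram-Schmidt makes the vectors orthogonal but not of norm one;
    \<open>s i\<close> is the reciprocal norm, and it is real, so conjugation does not change
    it.\<close>
  define s where "s i = complex_of_real (1 / sqrt (Re ((ws ! i) \<bullet>c (ws ! i))))" for i
  have cnj_s: "cnj (s i) = s i" for i by (simp add: s_def)
  define W where "W = mat n n (\<lambda>(i, j). s j * vec_index (ws ! j) i)"
  have wsc: "ws ! i \<in> carrier_vec n" if "i < n" for i using ws that by auto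
  have W: "W \<in> carrier_mat n n" unfolding W_def by simp
  have "mat_adjoint W * W = 1\<^sub>m n"
  proof (rule eq_matI)
    fix i j assume "i < dim_row (1\<^sub>m n)" "j < dim_col (1\<^sub>m n)"
    then have ij: "i < n" "j < n" by auto
    have "(mat_adjoint W * W) $$ (i, j) = (\<Sum>k<n. cnj (s i * vec_index (ws ! i) k) * (s j * vec_index (ws ! j) k))"
      using ij W by (auto simp: scalar_prod_def W_def atLeast0LessThan intro!: sum.cong)
    also have "\<dots> = s i * s j * ((ws ! j) \<bullet>c (ws ! i))"
      using carrier_vecD[OF wsc[OF ij(1)]] carrier_vecD[OF wsc[OF ij(2)]] ij
      by (simp add: scalar_prod_def sum_distrib_left atLeast0LessThan cnj_s mult_ac)
    also have "\<dots> = (if i = j then 1 else 0)"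
    proof (cases "i = j")
      case True
      have "(ws ! i) \<bullet>c (ws ! i) \<noteq> 0" using corthogonalD[OF ws(2), of i i] ij ws(3) by auto
      moreover have "(ws ! i) \<bullet>c (ws ! i) \<ge> 0" by auto
      ultimately have "Re ((ws ! i) \<bullet>c (ws ! i)) > 0"
        "(ws ! i) \<bullet>c (ws ! i) = complex_of_real (Re ((ws ! i) \<bullet>c (ws ! i)))"
        by (auto simp: less_eq_complex_def complex_eq_iff less_le)
      then obtain r where r: "r > 0" "(ws ! i) \<bullet>c (ws ! i) = complex_of_real r" by blast
      then have "s i * s i * ((ws ! i) \<bullet>c (ws ! i)) = complex_of_real (1 / sqrt r * (1 / sqrt r) * r)"
        unfolding s_def by (simp only: r(2) complex.sel Re_complex_of_real of_real_mult)
      also have "1 / sqrt r * (1 / sqrt r) * r = 1" using r(1) by simp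
      finally show ?thesis using True by simp
    next
      case False
      then show ?thesis using corthogonalD[OF ws(2), of j i] ij ws(3) by auto
    qed
    finally show "(mat_adjoint W * W) $$ (i, j) = 1\<^sub>m n $$ (i, j)" using ij by simp
  qed (use W in auto)
  moreover have "Matrix.col W 0 = s 0 \<cdot>\<^sub>v v"
    using v n ws0 by (intro eq_vecI) (auto simp: W_def)
  ultimately show thesis using W that by blast
qed

lemma hermitian_conjugate:
  assumes A: "A \<in> carrier_mat n n" "mat_adjoint A = A" and W: "W \<in> carrier_mat n m"
  shows "mat_adjoint (mat_adjoint W * A * W) = mat_adjoint W * A * W"
proof -
  have W': "mat_adjoint W \<in> carrier_mat m n" using W by simp
  show ?thesis
    unfolding mat_adjoint_mult[OF mult_carrier_mat[OF W' A(1)] W] mat_adjoint_mult[OF W' A(1)]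
    using assoc_mult_mat[OF W' A(1) W] A(2) by simp
qed

lemma conjugate_cancel:
  fixes A :: "complex mat"
  assumes A: "A \<in> carrier_mat n n" and U: "U \<in> carrier_mat n n" and U': "U' \<in> carrier_mat n n"
    and inv: "U * U' = 1\<^sub>m n"
  shows "U * (U' * A * U) * U' = A"
proof -
  have "U * (U' * A * U) * U' = (U * U') * A * (U * U')"
    using A U U' by (simp add: assoc_mult_mat[of _ n n _ n _ n])
  then show ?thesis using inv left_mult_one_mat[OF A] right_mult_one_mat[OF A] by simp
qed

text \<open>Deflation: in an orthonormal basis starting with an eigenvector the matrix splits as an
  eigenvalue and a Hermitian corner of size \<open>n\<close>, to which the induction hypothesis
  applies. The eigenvalues \<open>l\<close> stay complex here;
  \<open>hermitian_contraction_spectral\<close> derives that they are real from the quadratic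
  form.\<close>

theorem hermitian_unitary_diagonalization:
  fixes A :: "complex mat"
  assumes "A \<in> carrier_mat n n" "mat_adjoint A = A"
  shows "\<exists>U l. U \<in> carrier_mat n n \<and> mat_adjoint U * U = 1\<^sub>m n \<and> A = U * mat_diag n l * mat_adjoint U"
  using assms
proof (induction n arbitrary: A)
  case 0
  then show ?case
    by (intro exI[of _ "1\<^sub>m 0"] exI[of _ "\<lambda>_. 0"] conjI eq_matI) auto
next
  case (Suc n)
  obtain e where "e \<in> spectrum A" using spectrum_non_empty[OF Suc.prems(1)] by auto
  then obtain v where v: "v \<in> carrier_vec (Suc n)" "v \<noteq> 0\<^sub>v (Suc n)" and Av: "A *\<^sub>v v = e \<cdot>\<^sub>v v"
    using Suc.prems(1) by (auto simp: spectrum_def eigenvalue_def eigenvector_def)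
  obtain W c where W: "W \<in> carrier_mat (Suc n) (Suc n)" "mat_adjoint W * W = 1\<^sub>m (Suc n)"
    and W0: "Matrix.col W 0 = c \<cdot>\<^sub>v v"
    using orthonormal_completion[OF v] .
  define W' where "W' = mat_adjoint W"
  have W': "W' \<in> carrier_mat (Suc n) (Suc n)" using W by (simp add: W'_def)
  have WW': "W * W' = 1\<^sub>m (Suc n)"
    using mat_mult_left_right_inverse[OF W' W(1)] W(2) by (simp add: W'_def)
  define B where "B = W' * A * W"
  have B: "B \<in> carrier_mat (Suc n) (Suc n)" using W W' Suc.prems(1) by (simp add: B_def)
  have Bh: "mat_adjoint B = B"
    unfolding B_def W'_def by (rule hermitian_conjugate[OF Suc.prems W(1)])
  have B_herm: "B $$ (i, j) = cnj (B $$ (j, i))" if "i < Suc n" "j < Suc n" for i j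
    using hermitian_iff[OF B] Bh that by blast
  \<comment> \<open>The first column of \<open>W' * A * W\<close> is \<open>W'\<close> applied to
    \<open>e\<close> times the first column of \<open>W\<close>, hence \<open>e\<close> times the
    first unit vector.\<close>
  have B0: "B $$ (i, 0) = (if i = 0 then e else 0)" if "i < Suc n" for i
  proof -
    have "B $$ (i, 0) = vec_index (Matrix.col (W' * (A * W)) 0) i"
      using that B W W' Suc.prems by (simp add: B_def)
    also have "Matrix.col (W' * (A * W)) 0 = W' *\<^sub>v (A *\<^sub>v Matrix.col W 0)"
      using col_mult2[OF W' mult_carrier_mat[OF Suc.prems(1) W(1)], of 0]
        col_mult2[OF Suc.prems(1) W(1), of 0] by (simp only: zero_less_Suc)
    also have "A *\<^sub>v Matrix.col W 0 = e \<cdot>\<^sub>v Matrix.col W 0"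
      using Suc.prems(1) v Av by (simp add: W0 mult_mat_vec[of _ "Suc n" "Suc n"] smult_smult_assoc mult.commute)
    also have "W' *\<^sub>v (e \<cdot>\<^sub>v Matrix.col W 0) = e \<cdot>\<^sub>v Matrix.col (W' * W) 0"
      unfolding col_mult2[OF W' W(1) zero_less_Suc]
      by (rule mult_mat_vec[OF W' col_carrier_vec[OF zero_less_Suc W(1)]])
    finally show ?thesis using W(2) that by (simp add: W'_def)
  qed
  define C where "C = mat n n (\<lambda>(i, j). B $$ (Suc i, Suc j))"
  have C: "C \<in> carrier_mat n n" by (simp add: C_def)
  have "mat_adjoint C = C"
    unfolding hermitian_iff[OF C]
  proof (intro allI impI)
    fix i j assume "i < n" "j < n"
    then show "C $$ (i, j) = cnj (C $$ (j, i))"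
      using B_herm[of "Suc i" "Suc j"] by (simp add: C_def)
  qed
  from Suc.IH[OF C this] obtain V l where V: "V \<in> carrier_mat n n" "mat_adjoint V * V = 1\<^sub>m n"
    "C = V * mat_diag n l * mat_adjoint V" by auto
  \<comment> \<open>\<open>T\<close> is the direct sum of 1 and \<open>V\<close>, so that
    \<open>m\<close> lists \<open>e\<close> first and then the eigenvalues of the corner.\<close>
  define T where "T = mat (Suc n) (Suc n) (\<lambda>(i, j). if i = 0 \<or> j = 0 then (if i = j then 1 else 0) else V $$ (i - 1, j - 1))"
  define m where "m k = (if k = 0 then e else l (k - 1))" for k
  have T: "T \<in> carrier_mat (Suc n) (Suc n)" by (simp add: T_def)
  have T_index: "T $$ (0, 0) = 1" "i < n \<Longrightarrow> T $$ (0, Suc i) = 0" "i < n \<Longrightarrow> T $$ (Suc i, 0) = 0"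
    "i < n \<Longrightarrow> j < n \<Longrightarrow> T $$ (Suc i, Suc j) = V $$ (i, j)" for i j
    by (simp_all add: T_def)
  have Vi: "(\<Sum>k<n. cnj (V $$ (k, i)) * V $$ (k, j)) = (if i = j then 1 else 0)" if "i < n" "j < n" for i j
    using arg_cong[OF V(2), of "\<lambda>M. M $$ (i, j)"] that V(1)
    by (auto simp: scalar_prod_def atLeast0LessThan)
  have Ci: "(\<Sum>k<n. V $$ (i, k) * l k * cnj (V $$ (j, k))) = B $$ (Suc i, Suc j)" if "i < n" "j < n" for i j
    using arg_cong[OF V(3), of "\<lambda>M. M $$ (i, j)"] that V(1)
    by (auto simp: scalar_prod_def atLeast0LessThan C_def mat_diag_mult_right[OF V(1)])
  have TT: "mat_adjoint T * T = 1\<^sub>m (Suc n)"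
  proof (rule eq_matI)
    fix i j assume "i < dim_row (1\<^sub>m (Suc n))" "j < dim_col (1\<^sub>m (Suc n))"
    then have ij: "i < Suc n" "j < Suc n" by auto
    then have "(mat_adjoint T * T) $$ (i, j) = (\<Sum>k<Suc n. cnj (T $$ (k, i)) * T $$ (k, j))"
      using T by (auto simp: scalar_prod_def atLeast0LessThan intro!: sum.cong)
    also have "\<dots> = (if i = j then 1 else 0)"
      unfolding sum.lessThan_Suc_shift using ij Vi by (cases i; cases j) (auto simp: T_index)
    finally show "(mat_adjoint T * T) $$ (i, j) = 1\<^sub>m (Suc n) $$ (i, j)" using ij by simp
  qed (use T in auto)
  have BT: "B = T * mat_diag (Suc n) m * mat_adjoint T"
  proof (rule eq_matI)
    fix i j assume "i < dim_row (T * mat_diag (Suc n) m * mat_adjoint T)"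
      "j < dim_col (T * mat_diag (Suc n) m * mat_adjoint T)"
    then have ij: "i < Suc n" "j < Suc n" using T by auto
    then have *: "(T * mat_diag (Suc n) m * mat_adjoint T) $$ (i, j) = (\<Sum>k<Suc n. T $$ (i, k) * m k * cnj (T $$ (j, k)))"
      using T by (auto simp: scalar_prod_def atLeast0LessThan mat_diag_mult_right[OF T] intro!: sum.cong)
    \<comment> \<open>The rest of the first row vanishes because it is the conjugate of the first
      column; without it \<open>B\<close> would only be block triangular.\<close>
    have "B $$ (0, j) = (if j = 0 then e else 0)"
    proof (cases "j = 0")
      case False
      have "B $$ (0, j) = cnj (B $$ (j, 0))" using B_herm ij by blast
      then show ?thesis using B0[of j] False ij by simp
    qed (use B0[of 0] in simp)
    then show "B $$ (i, j) = (T * mat_diag (Suc n) m * mat_adjoint T) $$ (i, j)"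
      unfolding * sum.lessThan_Suc_shift using ij Ci B0
      by (cases i; cases j) (auto simp: T_index m_def)
  qed (use B T in auto)
  define T' where "T' = mat_adjoint T"
  have T': "T' \<in> carrier_mat (Suc n) (Suc n)" using T by (simp add: T'_def)
  have WT': "mat_adjoint (W * T) = T' * W'"
    unfolding T'_def W'_def by (rule mat_adjoint_mult[OF W(1) T])
  define D where "D = mat_diag (Suc n) m"
  have D: "D \<in> carrier_mat (Suc n) (Suc n)" by (simp add: D_def)
  have "A = W * B * W'"
    unfolding B_def using conjugate_cancel[OF Suc.prems(1) W(1) W' WW'] by simp
  also have "\<dots> = (W * T) * D * (T' * W')"
    unfolding BT T'_def[symmetric] D_def[symmetric] using W(1) T W' T' D
    by (simp add: assoc_mult_mat[of _ "Suc n" "Suc n" _ "Suc n" _ "Suc n"])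
  finally have "A = (W * T) * mat_diag (Suc n) m * mat_adjoint (W * T)" using WT' by (simp add: D_def)
  moreover have "mat_adjoint (W * T) * (W * T) = 1\<^sub>m (Suc n)"
  proof -
    have "mat_adjoint (W * T) * (W * T) = T' * ((W' * W) * T)"
      unfolding WT' using W(1) T W' T'
      by (simp add: assoc_mult_mat[of _ "Suc n" "Suc n" _ "Suc n" _ "Suc n"])
    then show ?thesis using W(2) TT T by (simp add: W'_def T'_def)
  qed
  moreover have "W * T \<in> carrier_mat (Suc n) (Suc n)" using W T by simp
  ultimately show ?case by blast
qed

section \<open>Diagonal operators and their joint spectrum\<close>

text \<open>Complex N-space, encoded by sequences that vanish from \<open>N\<close> on, because
  \<open>Wmin_level\<close> asks for a carrier made of functions from \<open>nat\<close> to
  \<open>complex\<close>.\<close>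

definition coord_space :: "nat \<Rightarrow> (nat \<Rightarrow> complex) hspace" where
  "coord_space N = \<lparr>carrier = {x. \<forall>k\<ge>N. x k = 0}, mult = undefined, one = undefined,
     zero = (\<lambda>_. 0), add = (\<lambda>x y k. x k + y k), smult = (\<lambda>c x k. c * x k),
     ip = (\<lambda>x y. \<Sum>k<N. x k * cnj (y k))\<rparr>"

lemma coord_space_simps [simp]:
  "carrier (coord_space N) = {x. \<forall>k\<ge>N. x k = 0}"
  "zero (coord_space N) = (\<lambda>_. 0)"
  "add (coord_space N) = (\<lambda>x y k. x k + y k)"
  "smult (coord_space N) = (\<lambda>c x k. c * x k)"
  "ip (coord_space N) = (\<lambda>x y. \<Sum>k<N. x k * cnj (y k))"
  by (simp_all add: coord_space_def)

lemma Cn_simps [simp]: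
  "carrier (Cn n) = carrier_vec n" "zero (Cn n) = 0\<^sub>v n" "add (Cn n) = (+)"
  "smult (Cn n) = (\<cdot>\<^sub>v)" "ip (Cn n) = (\<bullet>c)"
  by (simp_all add: Cn_def)

lemma hnorm_coord_space: "hnorm (coord_space N) x = sqrt (\<Sum>k<N. (cmod (x k))\<^sup>2)"
  by (simp add: hnorm_def complex_mult_cnj cmod_power2)

lemma abelian_group_coord_space: "abelian_group (coord_space N)"
proof (rule abelian_groupI)
  fix x assume "x \<in> carrier (coord_space N)"
  then show "\<exists>y\<in>carrier (coord_space N). y \<oplus>\<^bsub>coord_space N\<^esub> x = \<zero>\<^bsub>coord_space N\<^esub>"
    by (intro bexI[of _ "\<lambda>k. - x k"]) auto
qed (auto simp: algebra_simps)

lemma minus_coord_space: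
  assumes "x \<in> carrier (coord_space N)" "y \<in> carrier (coord_space N)"
  shows "x \<ominus>\<^bsub>coord_space N\<^esub> y = (\<lambda>k. x k - y k)"
proof -
  interpret abelian_group "coord_space N" by (rule abelian_group_coord_space)
  have "\<ominus>\<^bsub>coord_space N\<^esub> y = (\<lambda>k. - y k)"
    using assms by (intro minus_equality) auto
  then show ?thesis by (simp add: a_minus_def)
qed

lemma hilbert_space_coord_space: "hilbert_space (coord_space N)"
proof -
  let ?H = "coord_space N"
  have vs: "vectorspace (class_ring :: complex ring) ?H"
    unfolding vectorspace_def
  proof
    show "module class_ring ?H"
      by (rule moduleI[OF class_cring.cring_axioms abelian_group_coord_space])
        (auto simp: class_ring_simps algebra_simps)
  qed (rule class_field)
  show ?thesis
    unfolding hilbert_space_def hilbert_space_axioms_def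
  proof (intro conjI allI impI)
    show "vectorspace class_ring ?H" by (rule vs)
  next
    fix x assume x: "x \<in> carrier ?H" "x \<noteq> \<zero>\<^bsub>?H\<^esub>"
    then obtain k where k: "x k \<noteq> 0" by auto
    with x have "k < N" by (auto simp: not_le[symmetric])
    with k have "0 < (\<Sum>k<N. (cmod (x k))\<^sup>2)"
      by (intro sum_pos2[of _ k]) auto
    then show "0 < Re (ip ?H x x)"
      by (simp add: complex_mult_cnj cmod_power2)
  next
    fix s :: "nat \<Rightarrow> nat \<Rightarrow> complex"
    assume s: "\<forall>n. s n \<in> carrier ?H"
      and cauchy: "\<forall>e>0. \<exists>M. \<forall>m\<ge>M. \<forall>n\<ge>M. hnorm ?H (s m \<ominus>\<^bsub>?H\<^esub> s n) < e"
    have conv: "convergent (\<lambda>n. s n k)" if k: "k < N" for k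
    proof -
      have "Cauchy (\<lambda>n. s n k)"
        unfolding Cauchy_def
      proof (intro allI impI)
        fix e :: real assume "e > 0"
        then obtain M where M: "\<forall>m\<ge>M. \<forall>n\<ge>M. hnorm ?H (s m \<ominus>\<^bsub>?H\<^esub> s n) < e"
          using cauchy by blast
        have "dist (s m k) (s n k) < e" if "m \<ge> M" "n \<ge> M" for m n
        proof -
          have "(cmod (s m k - s n k))\<^sup>2 \<le> (\<Sum>k<N. (cmod (s m k - s n k))\<^sup>2)"
            using k by (intro member_le_sum) auto
          then have "cmod (s m k - s n k) \<le> hnorm ?H (s m \<ominus>\<^bsub>?H\<^esub> s n)"
            using s by (simp add: minus_coord_space hnorm_coord_space real_le_rsqrt)
          also have "\<dots> < e" using M that by blast
          finally show ?thesis by (simp add: dist_norm)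
        qed
        then show "\<exists>M. \<forall>m\<ge>M. \<forall>n\<ge>M. dist (s m k) (s n k) < e" by blast
      qed
      then show ?thesis by (rule Cauchy_convergent)
    qed
    \<comment> \<open>The limit is taken coordinatewise; the value 0 from \<open>N\<close> on keeps
      it in the carrier.\<close>
    define x where "x k = (if k < N then lim (\<lambda>n. s n k) else 0)" for k
    have x: "x \<in> carrier ?H" by (simp add: x_def)
    have "(\<lambda>n. s n k) \<longlonglongrightarrow> x k" if "k < N" for k
      using conv[OF that] that by (simp add: x_def convergent_LIMSEQ_iff)
    then have "(\<lambda>n. sqrt (\<Sum>k<N. (cmod (s n k - x k))\<^sup>2)) \<longlonglongrightarrow> sqrt (\<Sum>k<N. (cmod (x k - x k))\<^sup>2)"
      by (intro tendsto_intros) auto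
    then have "(\<lambda>n. hnorm ?H (s n \<ominus>\<^bsub>?H\<^esub> x)) \<longlonglongrightarrow> 0"
      using s x by (simp add: minus_coord_space hnorm_coord_space)
    with x show "\<exists>x\<in>carrier ?H. (\<lambda>n. hnorm ?H (s n \<ominus>\<^bsub>?H\<^esub> x)) \<longlonglongrightarrow> 0" by blast
  qed (auto simp: sum.distrib sum_distrib_left algebra_simps intro!: sum.cong)
qed

text \<open>\<open>adj\<close> is a definite description, so a candidate \<open>S\<close> gives
  existence and non-degeneracy of the inner product of \<open>H\<close> gives uniqueness; no
  representation theorem enters. Non-degeneracy is a hypothesis so that the rule covers both
  \<open>coord_space\<close> and \<open>Cn\<close> as the domain.\<close>

lemma adj_eqI:
  assumes S: "S \<in> carrier K \<rightarrow>\<^sub>E carrier H"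
    and adj: "\<And>x y. x \<in> carrier H \<Longrightarrow> y \<in> carrier K \<Longrightarrow> ip K (T x) y = ip H x (S y)"
    and nondegenerate: "\<And>z z'. z \<in> carrier H \<Longrightarrow> z' \<in> carrier H \<Longrightarrow>
      (\<And>x. x \<in> carrier H \<Longrightarrow> ip H x z = ip H x z') \<Longrightarrow> z = z'"
  shows "adj H K T = S"
proof
  fix y
  show "adj H K T y = S y"
  proof (cases "y \<in> carrier K")
    case True
    then have Sy: "S y \<in> carrier H" using S by auto
    have "(THE z. z \<in> carrier H \<and> (\<forall>x\<in>carrier H. ip K (T x) y = ip H x z)) = S y"
    proof (rule the_equality)
      show "S y \<in> carrier H \<and> (\<forall>x\<in>carrier H. ip K (T x) y = ip H x (S y))"
        using Sy adj True by blast
    next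
      fix z assume "z \<in> carrier H \<and> (\<forall>x\<in>carrier H. ip K (T x) y = ip H x z)"
      then show "z = S y" using adj True Sy by (intro nondegenerate) auto
    qed
    then show ?thesis using True by (simp add: adj_def)
  next
    case False
    then show ?thesis using S by (auto simp: adj_def PiE_def extensional_def)
  qed
qed

lemma coord_space_nondegenerate:
  assumes "z \<in> carrier (coord_space N)" "z' \<in> carrier (coord_space N)"
    and eq: "\<And>x. x \<in> carrier (coord_space N) \<Longrightarrow> ip (coord_space N) x z = ip (coord_space N) x z'"
  shows "z = z'"
proof
  fix k
  show "z k = z' k"
  proof (cases "k < N")
    case True
    have "(\<Sum>j<N. (if j = k then 1 else 0) * cnj (z j)) = (\<Sum>j<N. (if j = k then 1 else 0) * cnj (z' j))"
      using eq[of "\<lambda>j. if j = k then 1 else 0"] True by simp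
    then show ?thesis using True by (simp add: if_distrib[of "\<lambda>x. x * _"] cong: if_cong)
  qed (use assms in simp)
qed

lemma cscalar_sum:
  assumes "v \<in> carrier_vec n" "w \<in> carrier_vec n"
  shows "v \<bullet>c w = (\<Sum>i<n. vec_index v i * cnj (vec_index w i))"
  using assms by (auto simp: scalar_prod_def atLeast0LessThan intro!: sum.cong)

lemma Cn_nondegenerate:
  assumes z: "z \<in> carrier (Cn n)" "z' \<in> carrier (Cn n)"
    and eq: "\<And>x. x \<in> carrier (Cn n) \<Longrightarrow> ip (Cn n) x z = ip (Cn n) x z'"
  shows "z = z'"
proof (rule eq_vecI)
  fix k assume "k < dim_vec z'"
  then have k: "k < n" using z by auto
  have "(\<Sum>j<n. (if j = k then 1 else 0) * cnj (vec_index z j)) =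
    (\<Sum>j<n. (if j = k then 1 else 0) * cnj (vec_index z' j))"
    using eq[of "unit_vec n k"] z k
    by (simp add: cscalar_sum[of _ n] unit_vec_def if_distrib[of "\<lambda>x. x * _"] cong: if_cong)
  then show "vec_index z k = vec_index z' k"
    using k by (simp add: if_distrib[of "\<lambda>x. x * _"] cong: if_cong)
qed (use z in auto)

section \<open>The algebra of diagonal operators\<close>

definition diag_op :: "nat \<Rightarrow> (nat \<Rightarrow> complex) \<Rightarrow> (nat \<Rightarrow> complex) \<Rightarrow> (nat \<Rightarrow> complex)" where
  "diag_op N c = (\<lambda>x\<in>carrier (coord_space N). \<lambda>k. c k * x k)"

lemma diag_op_bounded: "diag_op N c \<in> bounded_ops (coord_space N) (coord_space N)"
proof -
  \<comment> \<open>Any bound will do, and the sum of the moduli dominates each single one without a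
    case split on \<open>N = 0\<close>, which a maximum would require.\<close>
  have "hnorm (coord_space N) (diag_op N c x) \<le> (\<Sum>k<N. cmod (c k)) * hnorm (coord_space N) x"
    if "x \<in> carrier (coord_space N)" for x
  proof -
    have "(\<Sum>k<N. (cmod (c k * x k))\<^sup>2) \<le> (\<Sum>k<N. (\<Sum>k<N. cmod (c k))\<^sup>2 * (cmod (x k))\<^sup>2)"
    proof (rule sum_mono)
      fix k assume "k \<in> {..<N}"
      then have "cmod (c k) \<le> (\<Sum>k<N. cmod (c k))" by (intro member_le_sum) auto
      then have "(cmod (c k))\<^sup>2 \<le> (\<Sum>k<N. cmod (c k))\<^sup>2" by (intro power_mono) auto
      then show "(cmod (c k * x k))\<^sup>2 \<le> (\<Sum>k<N. cmod (c k))\<^sup>2 * (cmod (x k))\<^sup>2"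
        by (simp add: norm_mult power_mult_distrib mult_right_mono)
    qed
    then have "sqrt (\<Sum>k<N. (cmod (c k * x k))\<^sup>2) \<le> sqrt ((\<Sum>k<N. cmod (c k))\<^sup>2 * (\<Sum>k<N. (cmod (x k))\<^sup>2))"
      by (simp add: sum_distrib_left)
    also have "\<dots> = (\<Sum>k<N. cmod (c k)) * sqrt (\<Sum>k<N. (cmod (x k))\<^sup>2)"
      by (simp add: real_sqrt_mult sum_nonneg)
    finally show ?thesis using that by (simp add: diag_op_def hnorm_coord_space)
  qed
  moreover have "diag_op N c \<in> linear_ops (coord_space N) (coord_space N)"
    by (auto simp: diag_op_def linear_ops_def algebra_simps)
  ultimately show ?thesis unfolding bounded_ops_def by blast
qed

lemma adj_diag_op: "adj (coord_space N) (coord_space N) (diag_op N c) = diag_op N (\<lambda>k. cnj (c k))"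
proof (rule adj_eqI)
  show "z = z'" if "z \<in> carrier (coord_space N)" "z' \<in> carrier (coord_space N)"
    "\<And>x. x \<in> carrier (coord_space N) \<Longrightarrow> ip (coord_space N) x z = ip (coord_space N) x z'" for z z'
    using that by (rule coord_space_nondegenerate)
qed (auto simp: diag_op_def mult_ac intro!: sum.cong)

lemma diag_op_comp:
  "op_comp (coord_space N) (diag_op N b) (diag_op N c) = diag_op N (\<lambda>k. b k * c k)"
  by (auto simp: op_comp_def diag_op_def compose_def fun_eq_iff mult_ac)

lemma diag_op_add:
  "op_add (coord_space N) (diag_op N b) (diag_op N c) = diag_op N (\<lambda>k. b k + c k)"
  by (auto simp: op_add_def diag_op_def fun_eq_iff algebra_simps)

lemma diag_op_smult:
  "op_smult (coord_space N) a (diag_op N c) = diag_op N (\<lambda>k. a * c k)"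
  by (auto simp: op_smult_def diag_op_def fun_eq_iff algebra_simps)

lemma diag_op_id: "op_id (coord_space N) = diag_op N (\<lambda>_. 1)"
  by (auto simp: op_id_def diag_op_def fun_eq_iff)

lemma diag_op_cong:
  assumes "\<And>k. k < N \<Longrightarrow> b k = c k"
  shows "diag_op N b = diag_op N c"
  unfolding diag_op_def
proof (intro restrict_ext ext)
  fix x k assume "x \<in> carrier (coord_space N)"
  then show "b k * x k = c k * x k" using assms by (cases "k < N") auto
qed

lemma commuting_normal_diag_op: "commuting_normal (coord_space N) (\<lambda>i. diag_op N (c i))"
  by (simp add: commuting_normal_def diag_op_bounded adj_diag_op diag_op_comp mult.commute)

section \<open>Characters of the generated algebra and the joint spectrum\<close>

lemma cstar_generated_base: "T \<in> G \<Longrightarrow> T \<in> cstar_generated H G"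
  unfolding cstar_generated_def by blast

lemma cstar_generated_id: "op_id H \<in> cstar_generated H G"
  unfolding cstar_generated_def unital_cstar_subalgebra_def by blast

lemma cstar_generated_closed:
  assumes "S \<in> cstar_generated H G" "T \<in> cstar_generated H G"
  shows "op_add H S T \<in> cstar_generated H G" "op_comp H S T \<in> cstar_generated H G"
    "op_smult H a T \<in> cstar_generated H G"
proof -
  have "op_add H S T \<in> \<A> \<and> op_comp H S T \<in> \<A> \<and> op_smult H a T \<in> \<A>"
    if "unital_cstar_subalgebra H \<A> \<and> G \<subseteq> \<A>" for \<A>
  proof -
    have "S \<in> \<A>" "T \<in> \<A>" using assms that unfolding cstar_generated_def by auto
    then show ?thesis using that unfolding unital_cstar_subalgebra_def by simp
  qed
  then show "op_add H S T \<in> cstar_generated H G" "op_comp H S T \<in> cstar_generated H G"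
    "op_smult H a T \<in> cstar_generated H G"
    unfolding cstar_generated_def by auto
qed

text \<open>
  If a character took the value \<open>z\<close> on the tuple and \<open>z\<close> differed from every \<open>c _ p\<close>, say in the
  coordinate \<open>s p\<close>, then it would map the vanishing product of the operators
  \<open>diag_op N (c (s p)) - c (s p) p\<close> to a nonzero number.
\<close>
lemma joint_spectrum_diag_op:
  "joint_spectrum (coord_space N) (\<lambda>i. diag_op N (c i)) \<subseteq> (\<lambda>p. \<chi> i. c i p) ` {..<N}"
proof
  let ?H = "coord_space N"
  let ?A = "cstar_generated ?H (range (\<lambda>i. diag_op N (c i)))"
  fix z assume "z \<in> joint_spectrum ?H (\<lambda>i. diag_op N (c i))"
  then obtain f where f: "character_on ?H ?A f" and z: "z = (\<chi> i. f (diag_op N (c i)))"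
    by (auto simp: joint_spectrum_def)
  have f_add: "f (op_add ?H S T) = f S + f T" and f_comp: "f (op_comp ?H S T) = f S * f T"
    and f_smult: "f (op_smult ?H a T) = a * f T" if "S \<in> ?A" "T \<in> ?A" for S T a
    using f that unfolding character_on_def by blast+
  have id: "diag_op N (\<lambda>_. 1) \<in> ?A" using cstar_generated_id[of ?H] by (simp add: diag_op_id)
  have one: "f (diag_op N (\<lambda>_. 1)) = 1"
  proof -
    obtain T where T: "T \<in> ?A" "f T \<noteq> 0" using f unfolding character_on_def by blast
    \<comment> \<open>Both sides are restrictions to the carrier, so they agree without knowing that
      \<open>T\<close> itself is extensional.\<close>
    have "op_comp ?H T (diag_op N (\<lambda>_. 1)) = op_smult ?H 1 T"
      by (auto simp: op_comp_def op_smult_def compose_def diag_op_def fun_eq_iff)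
    then have "f T * f (diag_op N (\<lambda>_. 1)) = f T"
      using f_comp[OF T(1) id] f_smult[OF T(1) T(1), of 1] by simp
    then show ?thesis using T(2) by simp
  qed
  show "z \<in> (\<lambda>p. \<chi> i. c i p) ` {..<N}"
  proof (rule ccontr)
    assume "z \<notin> (\<lambda>p. \<chi> i. c i p) ` {..<N}"
    then have "\<exists>i. f (diag_op N (c i)) \<noteq> c i p" if "p < N" for p
      using that by (force simp: z vec_eq_iff)
    then obtain s where s: "\<And>p. p < N \<Longrightarrow> f (diag_op N (c (s p))) \<noteq> c (s p) p" by metis
    define P where "P m = diag_op N (\<lambda>k. \<Prod>p<m. c (s p) k - c (s p) p)" for m
    have "P m \<in> ?A \<and> f (P m) = (\<Prod>p<m. f (diag_op N (c (s p))) - c (s p) p)" for m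
    proof (induction m)
      case 0
      then show ?case using id one by (simp add: P_def)
    next
      case (Suc m)
      define E where "E = diag_op N (\<lambda>k. c (s m) k - c (s m) m)"
      have base: "diag_op N (c (s m)) \<in> ?A" by (rule cstar_generated_base) simp
      have smult: "op_smult ?H (- c (s m) m) (diag_op N (\<lambda>_. 1)) \<in> ?A"
        by (rule cstar_generated_closed(3)[OF id id])
      have E: "E = op_add ?H (diag_op N (c (s m))) (op_smult ?H (- c (s m) m) (diag_op N (\<lambda>_. 1)))"
        by (simp add: E_def diag_op_smult diag_op_add)
      have EA: "E \<in> ?A" unfolding E by (rule cstar_generated_closed(1)[OF base smult])
      have fE: "f E = f (diag_op N (c (s m))) - c (s m) m"
        unfolding E f_add[OF base smult] f_smult[OF id id] one by simp
      have PS: "P (Suc m) = op_comp ?H (P m) E"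
        by (simp add: P_def E_def diag_op_comp)
      show ?case
        unfolding PS using Suc.IH cstar_generated_closed(2)[OF _ EA] f_comp[OF _ EA] fE by simp
    qed
    then have PN: "f (P N) = (\<Prod>p<N. f (diag_op N (c (s p))) - c (s p) p)" by blast
    \<comment> \<open>In coordinate \<open>k < N\<close> the factor with \<open>p = k\<close> is
      zero. The zero operator is written as 0 times the identity so that homogeneity of
      \<open>f\<close> gives the value 0.\<close>
    have "P N = op_smult ?H 0 (diag_op N (\<lambda>_. 1))"
      unfolding P_def diag_op_smult by (rule diag_op_cong) (simp, blast)
    then have "f (P N) = 0" using f_smult[OF id id, of 0] by simp
    then obtain p where "p < N" "f (diag_op N (c (s p))) = c (s p) p"
      unfolding PN by (auto simp: prod_zero_iff)
    then show False using s by blast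
  qed
qed

section \<open>Compressions of diagonal tuples in the minimal set\<close>

lemma sum_compression_apply:
  fixes w :: "nat \<Rightarrow> nat \<Rightarrow> complex"
  shows "(\<Sum>p<N. b p * (\<Sum>r<n. w p r * v r)) = (\<Sum>r<n. (\<Sum>p<N. b p * w p r) * v r)"
proof -
  have "(\<Sum>p<N. b p * (\<Sum>r<n. w p r * v r)) = (\<Sum>p<N. \<Sum>r<n. b p * w p r * v r)"
    by (simp add: sum_distrib_left mult.assoc)
  also have "\<dots> = (\<Sum>r<n. \<Sum>p<N. b p * w p r * v r)" by (rule sum.swap)
  finally show ?thesis by (simp add: sum_distrib_right)
qed

text \<open>A test for the minimal set by finite sums alone. The array \<open>w\<close> is the
  matrix of an isometry into complex N-space, and the points \<open>x p\<close> are the joint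
  eigenvalues of the diagonal operators, so \<open>joint_spectrum_diag_op\<close> places the
  spectrum in \<open>K\<close>.\<close>

lemma diag_compression_mem_Wmin_level:
  fixes X :: "'d::finite \<Rightarrow> complex mat" and x :: "nat \<Rightarrow> real^'d"
  assumes X: "X \<in> sa_tuples n"
    and w: "\<And>q r. q < n \<Longrightarrow> r < n \<Longrightarrow> (\<Sum>p<N. cnj (w p q) * w p r) = (if q = r then 1 else 0)"
    and K: "\<And>p. p < N \<Longrightarrow> x p \<in> K"
    and Xw: "\<And>i q r. q < n \<Longrightarrow> r < n \<Longrightarrow>
      X i $$ (q, r) = (\<Sum>p<N. cnj (w p q) * complex_of_real (x p $ i) * w p r)"
  shows "X \<in> Wmin_level K n"
proof -
  let ?H = "coord_space N"
  define c where "c i p = complex_of_real (x p $ i)" for i p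
  define V where "V = (\<lambda>v\<in>carrier_vec n. \<lambda>p. if p < N then \<Sum>q<n. w p q * vec_index v q else 0)"
  define Va where "Va = (\<lambda>y\<in>carrier ?H. Matrix.vec n (\<lambda>q. \<Sum>p<N. cnj (w p q) * y p))"
  have V_apply: "V v p = (\<Sum>q<n. w p q * vec_index v q)" if "v \<in> carrier_vec n" "p < N" for v p
    using that by (simp add: V_def)
  have V_carrier: "V v \<in> carrier ?H" if "v \<in> carrier_vec n" for v
    using that by (simp add: V_def)
  have Va_carrier: "Va y \<in> carrier_vec n" if "y \<in> carrier ?H" for y
    using that by (simp add: Va_def)
  have V_adj: "ip ?H (V v) y = ip (Cn n) v (Va y)" if v: "v \<in> carrier_vec n" and y: "y \<in> carrier ?H" for v y
  proof -
    have "ip ?H (V v) y = (\<Sum>p<N. cnj (y p) * (\<Sum>q<n. w p q * vec_index v q))"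
      using v by (simp add: V_apply mult.commute)
    also have "\<dots> = (\<Sum>q<n. (\<Sum>p<N. cnj (y p) * w p q) * vec_index v q)"
      by (rule sum_compression_apply)
    also have "\<dots> = (\<Sum>q<n. vec_index v q * cnj (vec_index (Va y) q))"
      using y by (simp add: Va_def mult.commute)
    also have "\<dots> = ip (Cn n) v (Va y)"
      using cscalar_sum[OF v Va_carrier[OF y]] by simp
    finally show ?thesis .
  qed
  have adjV: "adj (Cn n) ?H V = Va"
  proof (rule adj_eqI)
    show "Va \<in> carrier ?H \<rightarrow>\<^sub>E carrier (Cn n)"
      using Va_carrier by (auto simp: Va_def)
    show "ip ?H (V v) y = ip (Cn n) v (Va y)" if "v \<in> carrier (Cn n)" "y \<in> carrier ?H" for v y
      using V_adj that by simp
    show "z = z'" if "z \<in> carrier (Cn n)" "z' \<in> carrier (Cn n)"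
      "\<And>v. v \<in> carrier (Cn n) \<Longrightarrow> ip (Cn n) v z = ip (Cn n) v z'" for z z'
      using that by (rule Cn_nondegenerate)
  qed
  \<comment> \<open>Used twice: with \<open>a\<close> constantly 1 it shows that \<open>Va\<close>
    inverts \<open>V\<close> on the left, and with \<open>a = c i\<close> it identifies the
    compression with \<open>X i\<close>.\<close>
  have Va_diag_V: "vec_index (Va (\<lambda>p. a p * V v p)) q =
      (\<Sum>r<n. (\<Sum>p<N. cnj (w p q) * a p * w p r) * vec_index v r)"
    if v: "v \<in> carrier_vec n" and q: "q < n" for a v q
  proof -
    have "(\<lambda>p. a p * V v p) \<in> carrier ?H" using V_carrier[OF v] by simp
    then have "vec_index (Va (\<lambda>p. a p * V v p)) q = (\<Sum>p<N. (cnj (w p q) * a p) * (\<Sum>r<n. w p r * vec_index v r))"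
      using q v by (simp add: Va_def V_apply mult.assoc)
    then show ?thesis by (simp only: sum_compression_apply)
  qed
  have "V \<in> linear_ops (Cn n) ?H"
    unfolding linear_ops_def
  proof (intro CollectI conjI ballI allI)
    show "V \<in> carrier (Cn n) \<rightarrow>\<^sub>E carrier ?H" by (auto simp: V_def)
    show "V (u \<oplus>\<^bsub>Cn n\<^esub> v) = V u \<oplus>\<^bsub>?H\<^esub> V v" if "u \<in> carrier (Cn n)" "v \<in> carrier (Cn n)" for u v
      using that carrier_vecD[of u n] carrier_vecD[of v n]
      by (auto simp: V_def fun_eq_iff distrib_left sum.distrib)
    show "V (a \<odot>\<^bsub>Cn n\<^esub> v) = a \<odot>\<^bsub>?H\<^esub> V v" if "v \<in> carrier (Cn n)" for a v
      using that carrier_vecD[of v n] by (auto simp: V_def fun_eq_iff sum_distrib_left mult_ac)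
  qed
  moreover have "hnorm ?H (V v) = hnorm (Cn n) v" if "v \<in> carrier (Cn n)" for v
  proof -
    have v: "v \<in> carrier_vec n" using that by simp
    have "Va (V v) = v"
    proof (rule eq_vecI)
      fix q assume "q < dim_vec v"
      then have q: "q < n" using v by simp
      have "vec_index (Va (V v)) q = (\<Sum>r<n. (if q = r then 1 else 0) * vec_index v r)"
        using Va_diag_V[OF v q, of "\<lambda>_. 1"] w q by simp
      also have "\<dots> = (\<Sum>r<n. if q = r then vec_index v r else 0)"
        by (intro sum.cong) auto
      finally show "vec_index (Va (V v)) q = vec_index v q" using q by simp
    qed (use Va_carrier[OF V_carrier[OF v]] v in auto)
    \<comment> \<open>The square of the norm of \<open>V v\<close> is the inner product of
      \<open>v\<close> with \<open>Va (V v)\<close>, which is \<open>v\<close>.\<close>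
    then show ?thesis using V_adj[OF v V_carrier[OF v]] by (simp add: hnorm_def)
  qed
  ultimately have V_iso: "V \<in> isometry_ops (Cn n) ?H" by (simp add: isometry_ops_def)
  have "mat_op n (X i) = op_comp (Cn n) (adj (Cn n) ?H V) (op_comp (Cn n) (diag_op N (c i)) V)" for i
  proof
    fix v
    show "mat_op n (X i) v = op_comp (Cn n) (adj (Cn n) ?H V) (op_comp (Cn n) (diag_op N (c i)) V) v"
    proof (cases "v \<in> carrier_vec n")
      case True
      have Xi: "X i \<in> carrier_mat n n" using X by (simp add: sa_tuples_def)
      have diag: "diag_op N (c i) (V v) = (\<lambda>p. c i p * V v p)"
        using V_carrier[OF True] by (simp add: diag_op_def)
      have "X i *\<^sub>v v = Va (\<lambda>p. c i p * V v p)"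
      proof (rule eq_vecI)
        fix q assume "q < dim_vec (Va (\<lambda>p. c i p * V v p))"
        then have q: "q < n" using V_carrier[OF True] by (simp add: Va_def)
        have "vec_index (X i *\<^sub>v v) q = (\<Sum>r<n. X i $$ (q, r) * vec_index v r)"
          using q Xi True by (simp add: scalar_prod_def atLeast0LessThan)
        also have "\<dots> = vec_index (Va (\<lambda>p. c i p * V v p)) q"
          unfolding Va_diag_V[OF True q] using Xw q by (simp add: c_def)
        finally show "vec_index (X i *\<^sub>v v) q = vec_index (Va (\<lambda>p. c i p * V v p)) q" .
      qed (use V_carrier[OF True] Xi in \<open>simp add: Va_def\<close>)
      then show ?thesis
        using True by (simp add: mat_op_def op_comp_def compose_def adjV diag)
    qed (simp add: mat_op_def op_comp_def compose_def)
  qed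
  moreover have "joint_spectrum ?H (\<lambda>i. diag_op N (c i)) \<subseteq> (\<lambda>x. \<chi> i. complex_of_real (x $ i)) ` K"
    using joint_spectrum_diag_op[of N c] K unfolding c_def by blast
  ultimately show ?thesis
    unfolding Wmin_level_def
    using X V_iso hilbert_space_coord_space[of N] commuting_normal_diag_op[of N c] by blast
qed

section \<open>Compressions and matrix convex sets\<close>

text \<open>The form <A v, w>, taken on functions rather than on vectors so that no carrier
  conditions have to be carried along.\<close>

definition sesq :: "nat \<Rightarrow> complex mat \<Rightarrow> (nat \<Rightarrow> complex) \<Rightarrow> (nat \<Rightarrow> complex) \<Rightarrow> complex" where
  "sesq n A v w = (\<Sum>i<n. \<Sum>j<n. A $$ (i, j) * v j * cnj (w i))"

lemma mult_mat_vec_index: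
  assumes "A \<in> carrier_mat n n" "v \<in> carrier_vec n" "i < n"
  shows "vec_index (A *\<^sub>v v) i = (\<Sum>j<n. A $$ (i, j) * vec_index v j)"
  using assms by (simp add: scalar_prod_def atLeast0LessThan)

lemma mult_mat_vec_cscalar:
  assumes "A \<in> carrier_mat n n" "v \<in> carrier_vec n" "w \<in> carrier_vec n"
  shows "(A *\<^sub>v v) \<bullet>c w = sesq n A (vec_index v) (vec_index w)"
  using cscalar_sum[OF mult_mat_vec_carrier[OF assms(1,2)] assms(3)] mult_mat_vec_index[OF assms(1,2)]
  by (simp add: sesq_def sum_distrib_right)

lemma psd_iff:
  assumes "A \<in> carrier_mat n n"
  shows "psd n A \<longleftrightarrow> mat_adjoint A = A \<and> (\<forall>v. 0 \<le> Re (sesq n A v v))"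
proof -
  have "(\<forall>v\<in>carrier_vec n. 0 \<le> Re ((A *\<^sub>v v) \<bullet>c v)) \<longleftrightarrow> (\<forall>v. 0 \<le> Re (sesq n A v v))"
  proof (intro iffI allI ballI)
    fix v assume *: "\<forall>v\<in>carrier_vec n. 0 \<le> Re ((A *\<^sub>v v) \<bullet>c v)"
    have "(A *\<^sub>v Matrix.vec n v) \<bullet>c Matrix.vec n v = sesq n A v v"
      using assms by (simp add: mult_mat_vec_cscalar[of A n]) (simp add: sesq_def)
    then show "0 \<le> Re (sesq n A v v)" using *[rule_format, of "Matrix.vec n v"] by simp
  qed (use assms in \<open>simp add: mult_mat_vec_cscalar[of A n]\<close>)
  then show ?thesis using assms by (simp add: psd_def)
qed

lemma sum_swap_pairs:
  "(\<Sum>a\<in>A. \<Sum>b\<in>B. \<Sum>p\<in>P. \<Sum>q\<in>Q. f a b p q) = (\<Sum>p\<in>P. \<Sum>q\<in>Q. \<Sum>a\<in>A. \<Sum>b\<in>B. f a b p q)"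
proof -
  have "(\<Sum>a\<in>A. \<Sum>b\<in>B. \<Sum>p\<in>P. \<Sum>q\<in>Q. f a b p q) = (\<Sum>a\<in>A. \<Sum>p\<in>P. \<Sum>b\<in>B. \<Sum>q\<in>Q. f a b p q)"
    by (intro sum.cong refl) (rule sum.swap)
  also have "\<dots> = (\<Sum>p\<in>P. \<Sum>a\<in>A. \<Sum>b\<in>B. \<Sum>q\<in>Q. f a b p q)" by (rule sum.swap)
  also have "\<dots> = (\<Sum>p\<in>P. \<Sum>a\<in>A. \<Sum>q\<in>Q. \<Sum>b\<in>B. f a b p q)"
    by (intro sum.cong refl) (rule sum.swap)
  also have "\<dots> = (\<Sum>p\<in>P. \<Sum>q\<in>Q. \<Sum>a\<in>A. \<Sum>b\<in>B. f a b p q)"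
    by (intro sum.cong refl) (rule sum.swap)
  finally show ?thesis .
qed

text \<open>This is \<open>w^* A w\<close> for an N by k array \<open>w\<close>. As a function,
  \<open>w\<close> can be given by a formula, such as the block array in
  \<open>amplify_compress\<close>.\<close>

definition compress :: "nat \<Rightarrow> nat \<Rightarrow> (nat \<Rightarrow> nat \<Rightarrow> complex) \<Rightarrow> complex mat \<Rightarrow> complex mat" where
  "compress N k w A = mat k k (\<lambda>(a, b). \<Sum>p<N. \<Sum>q<N. cnj (w p a) * A $$ (p, q) * w q b)"

lemma compress_carrier [simp]: "compress N k w A \<in> carrier_mat k k"
  by (simp add: compress_def)

lemma compress_index:
  "a < k \<Longrightarrow> b < k \<Longrightarrow> compress N k w A $$ (a, b) = (\<Sum>p<N. \<Sum>q<N. cnj (w p a) * A $$ (p, q) * w q b)"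
  by (simp add: compress_def)

lemma sesq_compress:
  "sesq k (compress N k w A) v u = sesq N A (\<lambda>q. \<Sum>b<k. w q b * v b) (\<lambda>p. \<Sum>a<k. w p a * u a)"
proof -
  have "sesq k (compress N k w A) v u =
      (\<Sum>a<k. \<Sum>b<k. \<Sum>p<N. \<Sum>q<N. cnj (w p a) * A $$ (p, q) * w q b * v b * cnj (u a))"
    by (simp add: sesq_def compress_index sum_distrib_right)
  also have "\<dots> = (\<Sum>p<N. \<Sum>q<N. \<Sum>a<k. \<Sum>b<k. cnj (w p a) * A $$ (p, q) * w q b * v b * cnj (u a))"
    by (rule sum_swap_pairs)
  also have "\<dots> = sesq N A (\<lambda>q. \<Sum>b<k. w q b * v b) (\<lambda>p. \<Sum>a<k. w p a * u a)"
    unfolding sesq_def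
  proof (intro sum.cong refl)
    fix p q
    have "A $$ (p, q) * (\<Sum>b<k. w q b * v b) * cnj (\<Sum>a<k. w p a * u a) =
      (\<Sum>a<k. cnj (w p a * u a)) * (\<Sum>b<k. A $$ (p, q) * (w q b * v b))"
      by (simp add: sum_distrib_left mult_ac)
    also have "\<dots> = (\<Sum>a<k. \<Sum>b<k. cnj (w p a) * A $$ (p, q) * w q b * v b * cnj (u a))"
      unfolding sum_product by (simp add: mult_ac)
    finally show "(\<Sum>a<k. \<Sum>b<k. cnj (w p a) * A $$ (p, q) * w q b * v b * cnj (u a)) =
      A $$ (p, q) * (\<Sum>b<k. w q b * v b) * cnj (\<Sum>a<k. w p a * u a)" by simp
  qed
  finally show ?thesis .
qed

text \<open>The form of \<open>w^* A w\<close> at \<open>v\<close> is the form of \<open>A\<close>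
  at \<open>w v\<close>. The array \<open>w\<close> is arbitrary, so the lemma also covers the
  enlarged array of an amplification.\<close>

lemma psd_compress:
  assumes "psd N A"
  shows "psd k (compress N k w A)"
proof -
  have A: "A \<in> carrier_mat N N" "mat_adjoint A = A" using assms by (auto simp: psd_def)
  have A_herm: "cnj (A $$ (p, q)) = A $$ (q, p)" if "p < N" "q < N" for p q
  proof -
    have "A $$ (q, p) = cnj (A $$ (p, q))" using hermitian_iff[OF A(1)] A(2) that by blast
    then show ?thesis by (rule sym)
  qed
  have "mat_adjoint (compress N k w A) = compress N k w A"
    unfolding hermitian_iff[OF compress_carrier]
  proof (intro allI impI)
    fix a b assume ab: "a < k" "b < k"
    have "cnj (compress N k w A $$ (b, a)) = (\<Sum>p<N. \<Sum>q<N. cnj (w q a) * A $$ (q, p) * w p b)"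
      using ab by (simp add: compress_index A_herm mult_ac)
    also have "\<dots> = compress N k w A $$ (a, b)"
      using ab by (simp add: compress_index) (rule sum.swap)
    finally show "compress N k w A $$ (a, b) = cnj (compress N k w A $$ (b, a))" by simp
  qed
  moreover have "0 \<le> Re (sesq k (compress N k w A) v v)" for v
    unfolding sesq_compress using assms A(1) by (simp add: psd_iff)
  ultimately show ?thesis by (simp add: psd_iff)
qed

text \<open>Block summation by \<open>r = a * N + p\<close>; it serves both the blocks of an
  amplification and the \<open>d\<close> blocks of the dilation.\<close>

lemma sum_div_mod:
  fixes F :: "nat \<Rightarrow> nat \<Rightarrow> 'a::comm_monoid_add"
  shows "(\<Sum>r<m * N. F (r div N) (r mod N)) = (\<Sum>a<m. \<Sum>p<N. F a p)"
proof -
  have "(\<Sum>r<m * N. F (r div N) (r mod N)) = (\<Sum>a<m. \<Sum>r=a * N..<a * N + N. F (r div N) (r mod N))"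
    by (rule sum.nat_group[symmetric])
  also have "\<dots> = (\<Sum>a<m. \<Sum>p<N. F a p)"
  proof (rule sum.cong[OF refl])
    fix a
    show "(\<Sum>r=a * N..<a * N + N. F (r div N) (r mod N)) = (\<Sum>p<N. F a p)"
      using sum.shift_bounds_nat_ivl[of "\<lambda>r. F (r div N) (r mod N)" 0 "a * N" N]
      by (simp add: atLeast0LessThan add.commute)
  qed
  finally show ?thesis .
qed

text \<open>Amplifying the compression by \<open>w\<close> is compressing by the tensor product of
  the m by m identity with \<open>w\<close>. Complete positivity thereby reduces to positivity of a
  single compression.\<close>

lemma amplify_compress:
  "amplify m N k (compress N k w) A =
    compress (m * N) (m * k) (\<lambda>r i. if r div N = i div k then w (r mod N) (i mod k) else 0) A"
    (is "_ = compress _ _ ?w A")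
proof (rule eq_matI)
  fix i j
  assume "i < dim_row (compress (m * N) (m * k) ?w A)" "j < dim_col (compress (m * N) (m * k) ?w A)"
  then have ij: "i < m * k" "j < m * k" by (auto simp: compress_def)
  then have k: "k > 0" by (cases k) auto
  then have lt: "i div k < m" "j div k < m" "i mod k < k" "j mod k < k"
    using ij by (auto simp: less_mult_imp_div_less)
  \<comment> \<open>Summation against the indicator of block \<open>a\<close>. The full index is
    spelled out as \<open>r div N * N + r mod N\<close> so that the summand depends only on quotient
    and remainder, as \<open>sum_div_mod\<close> demands.\<close>
  have block: "(\<Sum>r<m * N. if r div N = a then f (r div N * N + r mod N) (r mod N) else 0) =
      (\<Sum>p<N. f (a * N + p) p)" if "a < m" for a and f :: "nat \<Rightarrow> nat \<Rightarrow> complex"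
  proof -
    have "(\<Sum>r<m * N. if r div N = a then f (r div N * N + r mod N) (r mod N) else 0) =
        (\<Sum>b<m. \<Sum>p<N. if b = a then f (b * N + p) p else 0)"
      using sum_div_mod[of "\<lambda>b p. if b = a then f (b * N + p) p else 0" N m] by simp
    also have "\<dots> = (\<Sum>b<m. if b = a then \<Sum>p<N. f (b * N + p) p else 0)"
      by (intro sum.cong) auto
    finally show ?thesis using that by simp
  qed
  have "compress (m * N) (m * k) ?w A $$ (i, j) =
      (\<Sum>r<m * N. \<Sum>s<m * N. cnj (?w r i) * A $$ (r, s) * ?w s j)"
    using ij by (simp add: compress_index)
  also have "\<dots> = (\<Sum>r<m * N. if r div N = i div k then
      (\<Sum>s<m * N. if s div N = j div k then
        cnj (w (r mod N) (i mod k)) * A $$ (r div N * N + r mod N, s div N * N + s mod N) * w (s mod N) (j mod k) else 0) else 0)"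
    unfolding div_mult_mod_eq by (auto intro!: sum.cong)
  also have "\<dots> = (\<Sum>p<N. \<Sum>s<m * N. if s div N = j div k then
        cnj (w p (i mod k)) * A $$ (i div k * N + p, s div N * N + s mod N) * w (s mod N) (j mod k) else 0)"
    by (rule block[OF lt(1), of "\<lambda>r p. \<Sum>s<m * N. if s div N = j div k then
        cnj (w p (i mod k)) * A $$ (r, s div N * N + s mod N) * w (s mod N) (j mod k) else 0"])
  also have "\<dots> = (\<Sum>p<N. \<Sum>q<N. cnj (w p (i mod k)) * A $$ (i div k * N + p, j div k * N + q) * w q (j mod k))"
  proof (rule sum.cong[OF refl])
    fix p
    show "(\<Sum>s<m * N. if s div N = j div k then
        cnj (w p (i mod k)) * A $$ (i div k * N + p, s div N * N + s mod N) * w (s mod N) (j mod k) else 0) =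
      (\<Sum>q<N. cnj (w p (i mod k)) * A $$ (i div k * N + p, j div k * N + q) * w q (j mod k))"
      by (rule block[OF lt(2), of "\<lambda>s q. cnj (w p (i mod k)) * A $$ (i div k * N + p, s) * w q (j mod k)"])
  qed
  also have "\<dots> = amplify m N k (compress N k w) A $$ (i, j)"
    using ij lt by (simp add: amplify_def compress_index)
  finally show "amplify m N k (compress N k w) A $$ (i, j) = compress (m * N) (m * k) ?w A $$ (i, j)" by simp
qed (simp_all add: amplify_def compress_def)

text \<open>Orthonormality of the columns of \<open>w\<close> is exactly unitality.\<close>

lemma ucp_compress:
  assumes w: "\<And>q r. q < n \<Longrightarrow> r < n \<Longrightarrow> (\<Sum>p<N. cnj (w p q) * w p r) = (if q = r then 1 else 0)"
  shows "ucp N n (compress N n w)"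
  unfolding ucp_def
proof (intro conjI ballI allI impI)
  show "compress N n w \<in> carrier_mat N N \<rightarrow> carrier_mat n n" by simp
  show "compress N n w (A + B) = compress N n w A + compress N n w B"
    if "A \<in> carrier_mat N N" "B \<in> carrier_mat N N" for A B
    using that by (intro eq_matI) (auto simp: compress_def algebra_simps sum.distrib intro!: sum.cong)
  show "compress N n w (c \<cdot>\<^sub>m A) = c \<cdot>\<^sub>m compress N n w A" if "A \<in> carrier_mat N N" for c A
    using that by (intro eq_matI) (auto simp: compress_def sum_distrib_left mult_ac intro!: sum.cong)
  show "compress N n w (1\<^sub>m N) = 1\<^sub>m n"
  proof (rule eq_matI)
    fix q r assume "q < dim_row (1\<^sub>m n)" "r < dim_col (1\<^sub>m n)"
    then have qr: "q < n" "r < n" by auto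
    have "compress N n w (1\<^sub>m N) $$ (q, r) = (\<Sum>p<N. \<Sum>s<N. if p = s then cnj (w p q) * w s r else 0)"
      unfolding compress_index[OF qr] by (intro sum.cong refl) auto
    then show "compress N n w (1\<^sub>m N) $$ (q, r) = 1\<^sub>m n $$ (q, r)" using qr w by simp
  qed (simp_all add: compress_def)
  show "psd (m * n) (amplify m N n (compress N n w) A)" if "psd (m * N) A" for m A
    unfolding amplify_compress using that by (rule psd_compress)
qed

section \<open>Direct sums and compressions inside a matrix convex set\<close>

lemma matrix_convex_direct_sum:
  assumes "matrix_convex \<S>" "X \<in> \<S>" "Y \<in> \<S>"
  shows "(\<lambda>i. diag_block_mat [X i, Y i]) \<in> \<S>"
  by (rule assms(1)[unfolded matrix_convex_def, THEN conjunct2, THEN conjunct1, rule_format, OF assms(2,3)])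

lemma matrix_convex_ucp:
  assumes "matrix_convex \<S>" "X \<in> \<S>" "X \<in> sa_tuples n" "n \<ge> 1" "k \<ge> 1" "ucp n k \<phi>"
  shows "(\<lambda>i. \<phi> (X i)) \<in> \<S>"
  by (rule assms(1)[unfolded matrix_convex_def, THEN conjunct2, THEN conjunct2, rule_format, OF assms(4,5) _ assms(6)])
    (use assms(2,3) in simp)

text \<open>The size is \<open>Suc m\<close> because a matrix convex set has no level zero: the
  induction has to start from one point, not from an empty direct sum.\<close>

lemma matrix_convex_diag:
  fixes x :: "nat \<Rightarrow> real^'d::finite"
  assumes "matrix_convex \<S>" "\<And>p. p \<le> m \<Longrightarrow> x p \<in> level_one \<S>"
  shows "(\<lambda>i. mat_diag (Suc m) (\<lambda>p. complex_of_real (x p $ i))) \<in> \<S>"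
  using assms(2)
proof (induction m)
  case 0
  have "mat_diag (Suc 0) (\<lambda>p. complex_of_real (x p $ i)) = mat 1 1 (\<lambda>_. complex_of_real (x 0 $ i))" for i
    by (rule eq_matI) (auto simp: mat_diag_def)
  then show ?case using 0[of 0] by (simp add: level_one_def)
next
  case (Suc m)
  let ?D = "\<lambda>i. mat_diag (Suc m) (\<lambda>p. complex_of_real (x p $ i))"
  let ?E = "\<lambda>i. mat 1 1 (\<lambda>_. complex_of_real (x (Suc m) $ i))"
  have "?D \<in> \<S>" "?E \<in> \<S>" using Suc by (auto simp: level_one_def)
  then have "(\<lambda>i. diag_block_mat [?D i, ?E i]) \<in> \<S>"
    by (rule matrix_convex_direct_sum[OF assms(1)])
  moreover have "diag_block_mat [?D i, ?E i] = mat_diag (Suc (Suc m)) (\<lambda>p. complex_of_real (x p $ i))" for i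
    by (rule eq_matI) (auto simp: mat_diag_def Let_def less_Suc_eq)
  ultimately show ?case by simp
qed

text \<open>Counterpart of \<open>diag_compression_mem_Wmin_level\<close> for the same data: the
  diagonal tuple is a direct sum of points of the first level, and \<open>X\<close> is its image
  under the UCP map \<open>compress N n w\<close>.\<close>

lemma diag_compression_mem_matrix_convex:
  fixes X :: "'d::finite \<Rightarrow> complex mat" and x :: "nat \<Rightarrow> real^'d"
  assumes S: "matrix_convex \<S>" and n: "n \<ge> 1" "N \<ge> 1" and X: "X \<in> sa_tuples n"
    and w: "\<And>q r. q < n \<Longrightarrow> r < n \<Longrightarrow> (\<Sum>p<N. cnj (w p q) * w p r) = (if q = r then 1 else 0)"
    and level_one: "\<And>p. p < N \<Longrightarrow> x p \<in> level_one \<S>"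
    and Xw: "\<And>i q r. q < n \<Longrightarrow> r < n \<Longrightarrow>
      X i $$ (q, r) = (\<Sum>p<N. cnj (w p q) * complex_of_real (x p $ i) * w p r)"
  shows "X \<in> \<S>"
proof -
  let ?D = "\<lambda>i. mat_diag N (\<lambda>p. complex_of_real (x p $ i))"
  have "?D \<in> \<S>"
    using matrix_convex_diag[OF S, of "N - 1" x] level_one n(2) by (cases N) auto
  moreover have "?D \<in> sa_tuples N"
    unfolding sa_tuples_def
  proof (intro CollectI allI conjI)
    fix i
    show "mat_adjoint (?D i) = ?D i"
      by (rule eq_matI) (auto simp: mat_diag_def)
  qed simp
  ultimately have "(\<lambda>i. compress N n w (?D i)) \<in> \<S>"
    by (rule matrix_convex_ucp[OF S _ _ n(2,1) ucp_compress[OF w]])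
  moreover have "compress N n w (?D i) = X i" for i
  proof (rule eq_matI)
    have Xi: "X i \<in> carrier_mat n n" using X by (simp add: sa_tuples_def)
    show "dim_row (compress N n w (?D i)) = dim_row (X i)" "dim_col (compress N n w (?D i)) = dim_col (X i)"
      using Xi by (simp_all add: compress_def)
    fix q r assume "q < dim_row (X i)" "r < dim_col (X i)"
    then have qr: "q < n" "r < n" using Xi by auto
    have "compress N n w (?D i) $$ (q, r) =
        (\<Sum>p<N. \<Sum>s<N. if p = s then cnj (w p q) * complex_of_real (x p $ i) * w s r else 0)"
      unfolding compress_index[OF qr] by (intro sum.cong refl) (auto simp: mat_diag_def)
    then show "compress N n w (?D i) $$ (q, r) = X i $$ (q, r)" using qr Xw by simp
  qed
  ultimately show ?thesis by simp
qed

section \<open>The matrix cube\<close>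

definition nsq :: "nat \<Rightarrow> (nat \<Rightarrow> complex) \<Rightarrow> real" where
  "nsq n v = (\<Sum>i<n. (cmod (v i))\<^sup>2)"

definition mat_apply :: "nat \<Rightarrow> complex mat \<Rightarrow> (nat \<Rightarrow> complex) \<Rightarrow> nat \<Rightarrow> complex" where
  "mat_apply n A v i = (\<Sum>j<n. A $$ (i, j) * v j)"

lemma nsq_nonneg: "0 \<le> nsq n v"
  by (simp add: nsq_def sum_nonneg)

lemma of_real_nsq: "complex_of_real (nsq n v) = (\<Sum>i<n. v i * cnj (v i))"
  unfolding nsq_def of_real_sum complex_norm_square ..

lemma hnorm_Cn: "v \<in> carrier_vec n \<Longrightarrow> hnorm (Cn n) v = sqrt (nsq n (vec_index v))"
  by (simp only: hnorm_def Cn_simps cscalar_sum of_real_nsq[symmetric] Re_complex_of_real)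

lemma sesq_mat_apply: "sesq n A v w = (\<Sum>i<n. mat_apply n A v i * cnj (w i))"
  by (simp add: sesq_def mat_apply_def sum_distrib_right)

lemma cnj_sesq:
  assumes A: "A \<in> carrier_mat n n" "mat_adjoint A = A"
  shows "cnj (sesq n A v w) = sesq n A w v"
proof -
  have herm: "cnj (A $$ (i, j)) = A $$ (j, i)" if "i < n" "j < n" for i j
  proof -
    have "A $$ (j, i) = cnj (A $$ (i, j))" using hermitian_iff[OF A(1)] A(2) that by blast
    then show ?thesis by (rule sym)
  qed
  have "cnj (sesq n A v w) = (\<Sum>i<n. \<Sum>j<n. A $$ (j, i) * w i * cnj (v j))"
    by (simp add: sesq_def herm mult_ac)
  also have "\<dots> = sesq n A w v" unfolding sesq_def by (rule sum.swap)
  finally show ?thesis .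
qed

text \<open>
  By polarization \<open>4 \<parallel>A v\<parallel>\<^sup>2\<close> is the difference of the values of the quadratic form at
  \<open>v + A v\<close> and \<open>v - A v\<close>, which the parallelogram law bounds by \<open>2 \<parallel>v\<parallel>\<^sup>2 + 2 \<parallel>A v\<parallel>\<^sup>2\<close>.
\<close>
lemma hermitian_contraction:
  assumes A: "A \<in> carrier_mat n n" "mat_adjoint A = A"
    and bound: "\<And>v. \<bar>Re (sesq n A v v)\<bar> \<le> nsq n v"
  shows "nsq n (mat_apply n A v) \<le> nsq n v"
proof -
  define w where "w = mat_apply n A v"
  define s t where "s = (\<lambda>i. v i + w i)" and "t = (\<lambda>i. v i - w i)"
  have "sesq n A s s = sesq n A v v + sesq n A v w + sesq n A w v + sesq n A w w"
    by (simp add: s_def sesq_def sum.distrib algebra_simps)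
  moreover have "sesq n A t t = sesq n A v v - sesq n A v w - sesq n A w v + sesq n A w w"
    by (simp add: t_def sesq_def sum.distrib sum_subtractf algebra_simps)
  moreover have "sesq n A v w = complex_of_real (nsq n w)"
    unfolding sesq_mat_apply of_real_nsq by (simp add: w_def)
  moreover have "sesq n A w v = cnj (sesq n A v w)" using cnj_sesq[OF A] by simp
  ultimately have "4 * nsq n w = Re (sesq n A s s) - Re (sesq n A t t)" by simp
  also have "\<dots> \<le> nsq n s + nsq n t" using bound[of s] bound[of t] by linarith
  also have "\<dots> = 2 * nsq n v + 2 * nsq n w"
    unfolding nsq_def s_def t_def sum_distrib_left sum.distrib[symmetric]
    unfolding cmod_power2 by (rule sum.cong) (simp_all add: power2_eq_square algebra_simps)
  finally show ?thesis by (simp add: w_def)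
qed

text \<open>Since both vectors have squared norm at most \<open>nsq n v\<close>, the termwise
  inequality 2ab <= a^2 + b^2 replaces Cauchy-Schwarz.\<close>

lemma contraction_quadratic_form:
  assumes "nsq n (mat_apply n A v) \<le> nsq n v"
  shows "\<bar>Re (sesq n A v v)\<bar> \<le> nsq n v"
proof -
  have "cmod (sesq n A v v) \<le> (\<Sum>i<n. cmod (mat_apply n A v i) * cmod (v i))"
    unfolding sesq_mat_apply by (rule order_trans[OF norm_sum]) (simp add: norm_mult)
  also have "\<dots> \<le> (\<Sum>i<n. ((cmod (mat_apply n A v i))\<^sup>2 + (cmod (v i))\<^sup>2) / 2)"
  proof (rule sum_mono)
    fix i
    show "cmod (mat_apply n A v i) * cmod (v i) \<le> ((cmod (mat_apply n A v i))\<^sup>2 + (cmod (v i))\<^sup>2) / 2"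
      using sum_squares_bound[of "cmod (mat_apply n A v i)" "cmod (v i)"] by simp
  qed
  also have "\<dots> = (nsq n (mat_apply n A v) + nsq n v) / 2"
    by (simp add: nsq_def sum.distrib flip: sum_divide_distrib)
  also have "\<dots> \<le> nsq n v" using assms by simp
  finally show ?thesis by (rule order_trans[OF abs_Re_le_cmod])
qed

lemma opnorm_le_one_iff:
  assumes A: "A \<in> carrier_mat n n"
  shows "opnorm (Cn n) (Cn n) (mat_op n A) \<le> 1 \<longleftrightarrow> (\<forall>v. nsq n (mat_apply n A v) \<le> nsq n v)"
proof
  let ?Q = "{hnorm (Cn n) (mat_op n A x) | x. x \<in> carrier (Cn n) \<and> hnorm (Cn n) x \<le> 1}"
  have norm_A: "hnorm (Cn n) (mat_op n A x) = sqrt (nsq n (mat_apply n A (vec_index x)))"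
    if "x \<in> carrier_vec n" for x
  proof -
    have "nsq n (vec_index (A *\<^sub>v x)) = nsq n (mat_apply n A (vec_index x))"
      unfolding nsq_def using mult_mat_vec_index[OF A that] by (simp add: mat_apply_def)
    then show ?thesis
      using hnorm_Cn[OF mult_mat_vec_carrier[OF A that]] that by (simp add: mat_op_def)
  qed
  {
    assume *: "\<forall>v. nsq n (mat_apply n A v) \<le> nsq n v"
    \<comment> \<open>The zero vector makes the set nonempty, which a bound on its supremum
      presupposes.\<close>
    have "hnorm (Cn n) (0\<^sub>v n) \<le> 1" by (simp add: hnorm_Cn nsq_def)
    then have "hnorm (Cn n) (mat_op n A (0\<^sub>v n)) \<in> ?Q" by fastforce
    moreover have "y \<le> 1" if "y \<in> ?Q" for y
    proof -
      from that obtain x where x: "x \<in> carrier_vec n" "hnorm (Cn n) x \<le> 1" "y = hnorm (Cn n) (mat_op n A x)"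
        by auto
      have "y \<le> sqrt (nsq n (vec_index x))"
        unfolding x(3) norm_A[OF x(1)] using * by (intro real_sqrt_le_mono) blast
      then show ?thesis using x(2) hnorm_Cn[OF x(1)] by linarith
    qed
    ultimately show "opnorm (Cn n) (Cn n) (mat_op n A) \<le> 1"
      unfolding opnorm_def by (intro cSup_least) blast+
  }
  {
    assume *: "opnorm (Cn n) (Cn n) (mat_op n A) \<le> 1"
    \<comment> \<open>A real supremum bounds its set only if the set is bounded. Entries of a vector
      in the unit ball have modulus at most 1, so the absolute row sums of \<open>A\<close> give a
      crude bound.\<close>
    have "bdd_above ?Q"
    proof (rule bdd_aboveI)
      fix y assume "y \<in> ?Q"
      then obtain x where x: "x \<in> carrier_vec n" "hnorm (Cn n) x \<le> 1" "y = hnorm (Cn n) (mat_op n A x)"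
        by auto
      have x_le: "cmod (vec_index x j) \<le> 1" if "j < n" for j
      proof -
        have "(cmod (vec_index x j))\<^sup>2 \<le> nsq n (vec_index x)"
          unfolding nsq_def using that by (intro member_le_sum) auto
        also have "\<dots> \<le> 1" using x(2) hnorm_Cn[OF x(1)] by simp
        finally show ?thesis by (simp add: power2_le_iff_abs_le abs_square_le_1)
      qed
      have "cmod (mat_apply n A (vec_index x) i) \<le> (\<Sum>j<n. cmod (A $$ (i, j)))" for i
        unfolding mat_apply_def
        by (rule order_trans[OF norm_sum]) (auto simp: norm_mult x_le intro!: sum_mono mult_left_le)
      then have "nsq n (mat_apply n A (vec_index x)) \<le> (\<Sum>i<n. (\<Sum>j<n. cmod (A $$ (i, j)))\<^sup>2)"
        unfolding nsq_def by (intro sum_mono power_mono) auto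
      then show "y \<le> sqrt (\<Sum>i<n. (\<Sum>j<n. cmod (A $$ (i, j)))\<^sup>2)"
        unfolding x(3) norm_A[OF x(1)] by (rule real_sqrt_le_mono)
    qed
    note upper = cSup_upper[OF _ this]
    show "\<forall>v. nsq n (mat_apply n A v) \<le> nsq n v"
    proof
      fix v
      show "nsq n (mat_apply n A v) \<le> nsq n v"
      proof (cases "nsq n v = 0")
        case True
        then have "v i = 0" if "i < n" for i
          using that by (simp add: nsq_def sum_nonneg_eq_0_iff)
        then have "nsq n (mat_apply n A v) = 0" by (simp add: nsq_def mat_apply_def)
        then show ?thesis by (simp add: nsq_nonneg)
      next
        case False
        \<comment> \<open>The supremum only sees the unit ball, so \<open>v\<close> is divided by
          its norm; both sides of the claim scale by the same factor.\<close>
        define t where "t = sqrt (nsq n v)"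
        have t: "t > 0" "t\<^sup>2 = nsq n v"
          using False nsq_nonneg[of n v] by (auto simp: t_def)
        define u where "u = Matrix.vec n (\<lambda>i. v i / complex_of_real t)"
        have u: "u \<in> carrier_vec n" by (simp add: u_def)
        have "nsq n (vec_index u) = nsq n v / t\<^sup>2"
          by (simp add: nsq_def u_def norm_divide power_divide sum_divide_distrib)
        then have "hnorm (Cn n) u \<le> 1" using hnorm_Cn[OF u] t False by simp
        then have "hnorm (Cn n) (mat_op n A u) \<le> Sup ?Q" using u by (intro upper) auto
        then have "sqrt (nsq n (mat_apply n A (vec_index u))) \<le> 1"
          using * norm_A[OF u] unfolding opnorm_def by linarith
        moreover have "nsq n (mat_apply n A (vec_index u)) = nsq n (mat_apply n A v) / t\<^sup>2"
        proof -
          have "mat_apply n A (vec_index u) i = mat_apply n A v i / complex_of_real t" for i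
            by (simp add: mat_apply_def u_def sum_divide_distrib)
          then show ?thesis
            by (simp add: nsq_def norm_divide power_divide sum_divide_distrib)
        qed
        ultimately show ?thesis using t False nsq_nonneg[of n v] by (auto simp: divide_le_eq_1)
      qed
    qed
  }
qed

section \<open>The maximal set over the cube in terms of quadratic forms\<close>

lemma sesq_lin_comb:
  "sesq n (lin_comb n \<alpha> X) v w = (\<Sum>i\<in>UNIV. complex_of_real (\<alpha> $ i) * sesq n (X i) v w)"
proof -
  have "sesq n (lin_comb n \<alpha> X) v w =
      (\<Sum>p<n. \<Sum>q<n. \<Sum>i\<in>UNIV. complex_of_real (\<alpha> $ i) * (X i $$ (p, q) * v q * cnj (w p)))"
    by (simp add: sesq_def lin_comb_def sum_distrib_right mult.assoc)
  also have "\<dots> = (\<Sum>p<n. \<Sum>i\<in>UNIV. \<Sum>q<n. complex_of_real (\<alpha> $ i) * (X i $$ (p, q) * v q * cnj (w p)))"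
    by (intro sum.cong refl) (rule sum.swap)
  also have "\<dots> = (\<Sum>i\<in>UNIV. \<Sum>p<n. \<Sum>q<n. complex_of_real (\<alpha> $ i) * (X i $$ (p, q) * v q * cnj (w p)))"
    by (rule sum.swap)
  finally show ?thesis by (simp add: sesq_def sum_distrib_left)
qed

lemma psd_half_space_iff:
  assumes X: "X \<in> sa_tuples n"
  shows "psd n (complex_of_real a \<cdot>\<^sub>m 1\<^sub>m n - lin_comb n \<alpha> X) \<longleftrightarrow>
    (\<forall>v. (\<Sum>i\<in>UNIV. \<alpha> $ i * Re (sesq n (X i) v v)) \<le> a * nsq n v)"
proof -
  let ?M = "complex_of_real a \<cdot>\<^sub>m 1\<^sub>m n - lin_comb n \<alpha> X"
  have M: "?M \<in> carrier_mat n n" by (intro minus_carrier_mat) (simp add: lin_comb_def)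
  have "mat_adjoint ?M = ?M"
    unfolding hermitian_iff[OF M]
  proof (intro allI impI)
    fix p q assume pq: "p < n" "q < n"
    have "X i $$ (p, q) = cnj (X i $$ (q, p))" for i
    proof -
      have Xi: "X i \<in> carrier_mat n n" "mat_adjoint (X i) = X i" using X by (auto simp: sa_tuples_def)
      show ?thesis using hermitian_iff[OF Xi(1)] Xi(2) pq by blast
    qed
    then have "lin_comb n \<alpha> X $$ (p, q) = cnj (lin_comb n \<alpha> X $$ (q, p))"
      using pq by (simp add: lin_comb_def)
    then show "?M $$ (p, q) = cnj (?M $$ (q, p))"
      using pq by (simp add: lin_comb_def)
  qed
  moreover have "Re (sesq n ?M v v) = a * nsq n v - (\<Sum>i\<in>UNIV. \<alpha> $ i * Re (sesq n (X i) v v))" for v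
  proof -
    have "sesq n ?M v v = (\<Sum>p<n. \<Sum>q<n. (if p = q then complex_of_real a * (v q * cnj (v p)) else 0)
        - lin_comb n \<alpha> X $$ (p, q) * v q * cnj (v p))"
      unfolding sesq_def by (intro sum.cong refl) (auto simp: lin_comb_def algebra_simps)
    also have "\<dots> = complex_of_real a * (\<Sum>p<n. v p * cnj (v p)) - sesq n (lin_comb n \<alpha> X) v v"
      by (simp add: sum_subtractf sesq_def sum_distrib_left)
    finally show ?thesis unfolding sesq_lin_comb of_real_nsq[symmetric] by simp
  qed
  ultimately show ?thesis by (simp add: psd_iff[OF M])
qed

text \<open>The coordinate half-spaces give the bounds on each \<open>X i\<close>. Conversely, a
  half-space with normal \<alpha> contains the cube only if \<open>a\<close> is at least the l1 norm
  of \<alpha>, and the coordinate bounds weighted by the moduli of its entries add up to the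
  required one.\<close>

lemma Wmax_level_cube_iff:
  assumes X: "X \<in> sa_tuples n"
  shows "X \<in> Wmax_level (cube :: (real^'d::finite) set) n \<longleftrightarrow> (\<forall>i v. \<bar>Re (sesq n (X i) v v)\<bar> \<le> nsq n v)"
proof -
  have "X \<in> Wmax_level (cube :: (real^'d) set) n \<longleftrightarrow>
    (\<forall>\<alpha> a. (\<forall>x\<in>(cube :: (real^'d) set). (\<Sum>i\<in>UNIV. \<alpha> $ i * x $ i) \<le> a) \<longrightarrow>
      (\<forall>v. (\<Sum>i\<in>UNIV. \<alpha> $ i * Re (sesq n (X i) v v)) \<le> a * nsq n v))"
    using X by (simp add: Wmax_level_def psd_half_space_iff)
  also have "\<dots> \<longleftrightarrow> (\<forall>i v. \<bar>Re (sesq n (X i) v v)\<bar> \<le> nsq n v)"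
  proof (intro iffI allI impI)
    fix i v
    assume *: "\<forall>\<alpha> a. (\<forall>x\<in>(cube :: (real^'d) set). (\<Sum>i\<in>UNIV. \<alpha> $ i * x $ i) \<le> a) \<longrightarrow>
      (\<forall>v. (\<Sum>i\<in>UNIV. \<alpha> $ i * Re (sesq n (X i) v v)) \<le> a * nsq n v)"
    have "c * Re (sesq n (X i) v v) \<le> nsq n v" if c: "c = 1 \<or> c = -1" for c
    proof -
      \<comment> \<open>Plus or minus the \<open>i\<close>-th unit vector, whose maximum over the
        cube is 1.\<close>
      define \<alpha> :: "real^'d" where "\<alpha> = (\<chi> j. if j = i then c else 0)"
      have sum: "(\<Sum>j\<in>UNIV. \<alpha> $ j * y j) = c * y i" for y
        by (simp add: \<alpha>_def if_distrib[of "\<lambda>x. x * _"] cong: if_cong)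
      have "\<forall>x\<in>cube. (\<Sum>j\<in>UNIV. \<alpha> $ j * x $ j) \<le> 1"
        unfolding sum using c by (auto simp: cube_def minus_le_iff)
      then show ?thesis using *[rule_format, of \<alpha> 1 v] by (simp add: sum)
    qed
    from this[of 1] this[of "-1"] show "\<bar>Re (sesq n (X i) v v)\<bar> \<le> nsq n v" by simp
  next
    fix \<alpha> :: "real^'d" and a v
    assume *: "\<forall>i v. \<bar>Re (sesq n (X i) v v)\<bar> \<le> nsq n v"
      and "\<forall>x\<in>(cube :: (real^'d) set). (\<Sum>i\<in>UNIV. \<alpha> $ i * x $ i) \<le> a"
    \<comment> \<open>The sign vector is the point of the cube at which the functional attains the
      l1 norm.\<close>
    moreover have "(\<chi> i. sgn (\<alpha> $ i)) \<in> cube" by (auto simp: cube_def sgn_if)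
    ultimately have "(\<Sum>i\<in>UNIV. \<alpha> $ i * sgn (\<alpha> $ i)) \<le> a" by fastforce
    then have a: "(\<Sum>i\<in>UNIV. \<bar>\<alpha> $ i\<bar>) \<le> a" by (simp add: abs_sgn)
    have "(\<Sum>i\<in>UNIV. \<alpha> $ i * Re (sesq n (X i) v v)) \<le> (\<Sum>i\<in>UNIV. \<bar>\<alpha> $ i\<bar> * nsq n v)"
    proof (rule sum_mono)
      fix i
      have "\<alpha> $ i * Re (sesq n (X i) v v) \<le> \<bar>\<alpha> $ i\<bar> * \<bar>Re (sesq n (X i) v v)\<bar>"
        by (metis abs_ge_self abs_mult)
      also have "\<dots> \<le> \<bar>\<alpha> $ i\<bar> * nsq n v" using * by (intro mult_left_mono) auto
      finally show "\<alpha> $ i * Re (sesq n (X i) v v) \<le> \<bar>\<alpha> $ i\<bar> * nsq n v" .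
    qed
    also have "\<dots> \<le> a * nsq n v"
      unfolding sum_distrib_right[symmetric] using a nsq_nonneg by (rule mult_right_mono)
    finally show "(\<Sum>i\<in>UNIV. \<alpha> $ i * Re (sesq n (X i) v v)) \<le> a * nsq n v" .
  qed
  finally show ?thesis .
qed

text \<open>Brings the matrix cube to the condition that \<open>Wmax_level_cube_iff\<close> finds
  for the maximal set. The quantifier over \<open>v\<close> stays inside each side because
  \<open>hermitian_contraction\<close> applies the bound at vectors other than
  \<open>v\<close>.\<close>

lemma matrix_cube_level_iff:
  assumes X: "X \<in> sa_tuples n"
  shows "(\<forall>i. opnorm (Cn n) (Cn n) (mat_op n (X i)) \<le> 1) \<longleftrightarrow> (\<forall>i v. \<bar>Re (sesq n (X i) v v)\<bar> \<le> nsq n v)"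
proof -
  have Xi: "X i \<in> carrier_mat n n" "mat_adjoint (X i) = X i" for i
    using X by (auto simp: sa_tuples_def)
  have "(\<forall>v. nsq n (mat_apply n (X i) v) \<le> nsq n v) \<longleftrightarrow> (\<forall>v. \<bar>Re (sesq n (X i) v v)\<bar> \<le> nsq n v)" for i
    using hermitian_contraction[OF Xi] contraction_quadratic_form by blast
  then show ?thesis by (simp only: opnorm_le_one_iff[OF Xi(1)])
qed

lemma matrix_cube_eq_Wmax: "(matrix_cube :: ('d::finite \<Rightarrow> complex mat) set) = Wmax (cube :: (real^'d) set)"
proof -
  have "{X \<in> sa_tuples n. \<forall>i. opnorm (Cn n) (Cn n) (mat_op n (X i)) \<le> 1} = Wmax_level (cube :: (real^'d) set) n" for n
  proof (rule Set.set_eqI)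
    fix X :: "'d \<Rightarrow> complex mat"
    show "X \<in> {X \<in> sa_tuples n. \<forall>i. opnorm (Cn n) (Cn n) (mat_op n (X i)) \<le> 1} \<longleftrightarrow> X \<in> Wmax_level (cube :: (real^'d) set) n"
    proof (cases "X \<in> sa_tuples n")
      case True
      then show ?thesis by (simp add: matrix_cube_level_iff Wmax_level_cube_iff)
    next
      case False
      then show ?thesis by (simp add: Wmax_level_def)
    qed
  qed
  then show ?thesis by (simp add: matrix_cube_def Wmax_def)
qed

section \<open>Dilation of the matrix cube\<close>

text \<open>Each eigenvalue is the value of the quadratic form at a unit eigenvector, hence real and
  of modulus at most 1. Orthonormality is stated for the rows of \<open>u\<close>, since these
  become the columns of the stacked adjoints.\<close>

lemma hermitian_contraction_spectral:
  fixes A :: "complex mat"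
  assumes A: "A \<in> carrier_mat n n" "mat_adjoint A = A"
    and bound: "\<And>v. \<bar>Re (sesq n A v v)\<bar> \<le> nsq n v"
  shows "\<exists>(u :: nat \<Rightarrow> nat \<Rightarrow> complex) (l :: nat \<Rightarrow> real).
    (\<forall>q<n. \<forall>r<n. (\<Sum>k<n. u q k * cnj (u r k)) = (if q = r then 1 else 0)) \<and>
    (\<forall>k<n. \<bar>l k\<bar> \<le> 1) \<and>
    (\<forall>q<n. \<forall>r<n. A $$ (q, r) = (\<Sum>k<n. u q k * complex_of_real (l k) * cnj (u r k)))"
proof -
  obtain U l where U: "U \<in> carrier_mat n n" "mat_adjoint U * U = 1\<^sub>m n"
    and AU: "A = U * mat_diag n l * mat_adjoint U"
    using hermitian_unitary_diagonalization[OF A] by blast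
  define U' where "U' = mat_adjoint U"
  have U': "U' \<in> carrier_mat n n" using U by (simp add: U'_def)
  \<comment> \<open>For square matrices a left inverse is a right inverse; this turns orthonormal
    columns into orthonormal rows.\<close>
  have UU': "U * U' = 1\<^sub>m n"
    using mat_mult_left_right_inverse[OF U' U(1)] U(2) by (simp add: U'_def)
  have rows: "(\<Sum>k<n. U $$ (q, k) * cnj (U $$ (r, k))) = (if q = r then 1 else 0)"
    if "q < n" "r < n" for q r
    using arg_cong[OF UU', of "\<lambda>M. M $$ (q, r)"] that U(1)
    by (simp add: scalar_prod_def atLeast0LessThan U'_def)
  have cols: "(\<Sum>i<n. cnj (U $$ (i, j)) * U $$ (i, k)) = (if j = k then 1 else 0)"
    if "j < n" "k < n" for j k
    using arg_cong[OF U(2), of "\<lambda>M. M $$ (j, k)"] that U(1)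
    by (simp add: scalar_prod_def atLeast0LessThan)
  have A_index: "A $$ (q, r) = (\<Sum>k<n. U $$ (q, k) * l k * cnj (U $$ (r, k)))"
    if "q < n" "r < n" for q r
    using arg_cong[OF AU, of "\<lambda>M. M $$ (q, r)"] that U(1)
    by (simp add: scalar_prod_def atLeast0LessThan mat_diag_mult_right[OF U(1)])
  \<comment> \<open>Column \<open>k\<close> of \<open>U\<close> is a unit eigenvector for
    \<open>l k\<close>; the form at it equals \<open>l k\<close>, and Hermitian symmetry makes that
    number its own conjugate.\<close>
  have l: "l k = complex_of_real (Re (l k)) \<and> \<bar>Re (l k)\<bar> \<le> 1" if k: "k < n" for k
  proof -
    let ?v = "\<lambda>i. U $$ (i, k)"
    have "mat_apply n A ?v i = l k * U $$ (i, k)" if i: "i < n" for i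
    proof -
      have "mat_apply n A ?v i = (\<Sum>j<n. \<Sum>m<n. U $$ (i, m) * l m * (cnj (U $$ (j, m)) * U $$ (j, k)))"
        using i by (simp add: mat_apply_def A_index sum_distrib_right mult.assoc)
      also have "\<dots> = (\<Sum>m<n. \<Sum>j<n. U $$ (i, m) * l m * (cnj (U $$ (j, m)) * U $$ (j, k)))"
        by (rule sum.swap)
      also have "\<dots> = (\<Sum>m<n. U $$ (i, m) * l m * (if m = k then 1 else 0))"
        unfolding sum_distrib_left[symmetric] using cols k by simp
      also have "\<dots> = (\<Sum>m<n. if m = k then U $$ (i, m) * l m else 0)"
        by (intro sum.cong) auto
      finally show ?thesis using k by (simp add: mult.commute)
    qed
    then have "sesq n A ?v ?v = l k * (\<Sum>i<n. ?v i * cnj (?v i))"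
      unfolding sesq_mat_apply sum_distrib_left by (simp add: mult.assoc)
    moreover have unit: "(\<Sum>i<n. ?v i * cnj (?v i)) = 1" using cols[OF k k] by (simp add: mult.commute)
    ultimately have val: "sesq n A ?v ?v = l k" by simp
    have "nsq n ?v = 1" using of_real_nsq[of n ?v] unit by (simp only: of_real_eq_1_iff)
    then have "\<bar>Re (l k)\<bar> \<le> 1" using bound[of ?v] val by simp
    moreover have "cnj (l k) = l k" using cnj_sesq[OF A, of ?v ?v] val by simp
    ultimately show ?thesis by (simp add: complex_eq_iff)
  qed
  show ?thesis
  proof (intro exI conjI allI impI)
    show "(\<Sum>k<n. U $$ (q, k) * cnj (U $$ (r, k))) = (if q = r then 1 else 0)" if "q < n" "r < n" for q r
      using rows that .
    show "\<bar>Re (l k)\<bar> \<le> 1" if "k < n" for k using l[OF that] ..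
    show "A $$ (q, r) = (\<Sum>k<n. U $$ (q, k) * complex_of_real (Re (l k)) * cnj (U $$ (r, k)))"
      if "q < n" "r < n" for q r
      unfolding A_index[OF that]
    proof (rule sum.cong[OF refl])
      fix k assume "k \<in> {..<n}"
      then have "l k = complex_of_real (Re (l k))" using l by blast
      then show "U $$ (q, k) * l k * cnj (U $$ (r, k)) =
        U $$ (q, k) * complex_of_real (Re (l k)) * cnj (U $$ (r, k))" by (rule arg_cong)
    qed
  qed
qed

lemma cube_diag_compression:
  fixes X :: "'d::finite \<Rightarrow> complex mat"
  assumes X: "X \<in> sa_tuples n" and bound: "\<And>i v. \<bar>Re (sesq n (X i) v v)\<bar> \<le> nsq n v"
  obtains w :: "nat \<Rightarrow> nat \<Rightarrow> complex" and x :: "nat \<Rightarrow> real^'d"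
  where "\<And>q r. q < n \<Longrightarrow> r < n \<Longrightarrow>
      (\<Sum>p<CARD('d) * n. cnj (w p q) * w p r) = (if q = r then 1 else 0)"
    and "\<And>p. p < CARD('d) * n \<Longrightarrow> x p \<in> diamond"
    and "\<And>i q r. q < n \<Longrightarrow> r < n \<Longrightarrow> complex_of_real (1 / CARD('d)) * X i $$ (q, r) =
      (\<Sum>p<CARD('d) * n. cnj (w p q) * complex_of_real (x p $ i) * w p r)"
proof -
  let ?d = "CARD('d)"
  have Xi: "X i \<in> carrier_mat n n" "mat_adjoint (X i) = X i" for i
    using X by (auto simp: sa_tuples_def)
  define P where "P i u l \<longleftrightarrow>
      (\<forall>q<n. \<forall>r<n. (\<Sum>k<n. u q k * cnj (u r k)) = (if q = r then 1 else 0)) \<and>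
      (\<forall>k<n. \<bar>l k\<bar> \<le> 1) \<and>
      (\<forall>q<n. \<forall>r<n. X i $$ (q, r) = (\<Sum>k<n. u q k * complex_of_real (l k) * cnj (u r k)))"
    for i and u :: "nat \<Rightarrow> nat \<Rightarrow> complex" and l :: "nat \<Rightarrow> real"
  have "\<exists>u l. P i u l" for i
    unfolding P_def by (rule hermitian_contraction_spectral[OF Xi bound])
  then obtain u l where P: "\<And>i. P i (u i) (l i)" by metis
  have u: "(\<Sum>k<n. u i q k * cnj (u i r k)) = (if q = r then 1 else 0)"
    and Xu: "X i $$ (q, r) = (\<Sum>k<n. u i q k * complex_of_real (l i k) * cnj (u i r k))"
    if "q < n" "r < n" for i q r
    using P[of i] that unfolding P_def by blast+
  have l: "\<bar>l i k\<bar> \<le> 1" if "k < n" for i k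
    using P[of i] that unfolding P_def by blast
  \<comment> \<open>Blocks are numbered by naturals and coordinates by the type \<open>'d\<close>;
    \<open>h\<close> tells which coordinate owns a block.\<close>
  obtain h where h: "bij_betw h {..<?d} (UNIV :: 'd set)"
    using ex_bij_betw_nat_finite[of "UNIV :: 'd set"] by (auto simp: atLeast0LessThan)
  \<comment> \<open>Each block contributes one identity matrix to the Gram matrix of
    \<open>w\<close>, so \<open>t * t\<close> has to be 1/d.\<close>
  define t where "t = complex_of_real (1 / sqrt ?d)"
  have t: "cnj t = t" "t * t = complex_of_real (1 / ?d)"
    by (simp add: t_def) (simp only: t_def of_real_mult[symmetric], simp)
  have t_sum: "t * t * of_nat ?d = 1" unfolding t by simp
  define w where "w p q = t * cnj (u (h (p div n)) q (p mod n))" for p q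
  define x :: "nat \<Rightarrow> real^'d"
    where "x p = (\<chi> i. if i = h (p div n) then l i (p mod n) else 0)" for p
  have blocks: "(\<Sum>p<?d * n. f (h (p div n)) (p mod n)) = (\<Sum>j\<in>UNIV. \<Sum>k<n. f j k)"
    for f :: "'d \<Rightarrow> nat \<Rightarrow> complex"
    unfolding sum_div_mod[of "\<lambda>a. f (h a)" n ?d]
    by (rule sum.reindex_bij_betw[OF h])
  show thesis
  proof
    fix q r assume qr: "q < n" "r < n"
    have "(\<Sum>p<?d * n. cnj (w p q) * w p r) = (\<Sum>j\<in>UNIV. \<Sum>k<n. t * t * (u j q k * cnj (u j r k)))"
      using blocks[of "\<lambda>j k. t * t * (u j q k * cnj (u j r k))"] by (simp add: w_def t(1) mult_ac)
    also have "\<dots> = (if q = r then 1 else 0)"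
      unfolding sum_distrib_left[symmetric] u[OF qr] using t_sum by (simp add: mult.assoc)
    finally show "(\<Sum>p<?d * n. cnj (w p q) * w p r) = (if q = r then 1 else 0)" .
  next
    fix p assume "p < ?d * n"
    \<comment> \<open>An index below \<open>?d * n\<close> exists only for positive
      \<open>n\<close>, which rules out a remainder modulo 0.\<close>
    then have "p mod n < n" by (cases n) auto
    moreover have "(\<Sum>j\<in>UNIV. \<bar>x p $ j\<bar>) = (\<Sum>j\<in>UNIV. if j = h (p div n) then \<bar>l j (p mod n)\<bar> else 0)"
      by (intro sum.cong) (auto simp: x_def)
    ultimately show "x p \<in> diamond" using l by (simp add: diamond_def)
  next
    fix i q r assume qr: "q < n" "r < n"
    have "(\<Sum>p<?d * n. cnj (w p q) * complex_of_real (x p $ i) * w p r) =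
        (\<Sum>p<?d * n. if h (p div n) = i then
          t * t * (u i q (p mod n) * complex_of_real (l i (p mod n)) * cnj (u i r (p mod n))) else 0)"
      by (intro sum.cong) (auto simp: w_def x_def t(1) mult_ac)
    also have "\<dots> = (\<Sum>j\<in>UNIV. \<Sum>k<n. if j = i then
          t * t * (u i q k * complex_of_real (l i k) * cnj (u i r k)) else 0)"
      by (rule blocks[of "\<lambda>j k. if j = i then
          t * t * (u i q k * complex_of_real (l i k) * cnj (u i r k)) else 0"])
    also have "\<dots> = (\<Sum>j\<in>UNIV. if j = i then t * t * X i $$ (q, r) else 0)"
      by (intro sum.cong) (auto simp: Xu[OF qr] sum_distrib_left)
    also have "\<dots> = complex_of_real (1 / ?d) * X i $$ (q, r)" by (simp add: t)
    finally show "complex_of_real (1 / ?d) * X i $$ (q, r) =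
      (\<Sum>p<?d * n. cnj (w p q) * complex_of_real (x p $ i) * w p r)" by simp
  qed
qed

lemma mem_scale_tuples:
  assumes "c \<noteq> 0" "(\<lambda>i. complex_of_real (1 / c) \<cdot>\<^sub>m X i) \<in> \<S>"
  shows "X \<in> scale_tuples c \<S>"
proof -
  have "complex_of_real c \<cdot>\<^sub>m (complex_of_real (1 / c) \<cdot>\<^sub>m X i) = X i" for i
    using assms(1) by (intro eq_matI) auto
  then show ?thesis using assms(2) unfolding scale_tuples_def by (intro image_eqI) auto
qed

lemma scale_sa_tuples:
  assumes "X \<in> sa_tuples n"
  shows "(\<lambda>i. complex_of_real c \<cdot>\<^sub>m X i) \<in> sa_tuples n"
  unfolding sa_tuples_def
proof (intro CollectI allI conjI)
  fix i
  have Xi: "X i \<in> carrier_mat n n" "mat_adjoint (X i) = X i" using assms by (auto simp: sa_tuples_def)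
  then show "complex_of_real c \<cdot>\<^sub>m X i \<in> carrier_mat n n" by simp
  have "mat_adjoint (complex_of_real c \<cdot>\<^sub>m X i) = complex_of_real c \<cdot>\<^sub>m mat_adjoint (X i)"
    by (rule eq_matI) auto
  then show "mat_adjoint (complex_of_real c \<cdot>\<^sub>m X i) = complex_of_real c \<cdot>\<^sub>m X i"
    using Xi(2) by simp
qed

theorem corollary10p11:
  shows "(matrix_cube :: ('d::finite \<Rightarrow> complex mat) set) = Wmax (cube :: (real^'d) set) \<and>
    Wmax (cube :: (real^'d) set) \<subseteq> scale_tuples (real CARD('d)) (Wmin (diamond :: (real^'d) set)) \<and>
    (\<forall>\<S> :: ('d \<Rightarrow> complex mat) set. matrix_convex \<S> \<longrightarrow>
       (diamond :: (real^'d) set) \<subseteq> level_one \<S> \<longrightarrow>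
       (matrix_cube :: ('d \<Rightarrow> complex mat) set) \<subseteq> scale_tuples (real CARD('d)) \<S>)"
proof -
  let ?d = "CARD('d)"
  \<comment> \<open>The two memberships are proved together because the same \<open>w\<close> and
    \<open>x\<close> witness both for the tuple \<open>X\<close> divided by
    \<open>d\<close>.\<close>
  have scaled_mem: "X \<in> scale_tuples (real ?d) (Wmin (diamond :: (real^'d) set)) \<and>
      (\<forall>\<S>. matrix_convex \<S> \<longrightarrow> (diamond :: (real^'d) set) \<subseteq> level_one \<S> \<longrightarrow> X \<in> scale_tuples (real ?d) \<S>)"
    if mem: "X \<in> Wmax (cube :: (real^'d) set)" for X :: "'d \<Rightarrow> complex mat"
  proof -
    obtain n where n: "n \<ge> 1" and Xn: "X \<in> Wmax_level (cube :: (real^'d) set) n"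
      using mem by (auto simp: Wmax_def)
    have X: "X \<in> sa_tuples n" using Xn by (simp add: Wmax_level_def)
    define Y where "Y i = complex_of_real (1 / real ?d) \<cdot>\<^sub>m X i" for i
    have Y: "Y \<in> sa_tuples n" unfolding Y_def by (rule scale_sa_tuples[OF X])
    have bound: "\<And>i v. \<bar>Re (sesq n (X i) v v)\<bar> \<le> nsq n v"
      using Xn Wmax_level_cube_iff[OF X] by blast
    obtain w x where w: "\<And>q r. q < n \<Longrightarrow> r < n \<Longrightarrow>
        (\<Sum>p<?d * n. cnj (w p q) * w p r) = (if q = r then 1 else 0)"
      and x: "\<And>p. p < ?d * n \<Longrightarrow> (x p :: real^'d) \<in> diamond"
      and Xw: "\<And>i q r. q < n \<Longrightarrow> r < n \<Longrightarrow> complex_of_real (1 / ?d) * X i $$ (q, r) =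
        (\<Sum>p<?d * n. cnj (w p q) * complex_of_real (x p $ i) * w p r)"
      by (rule cube_diag_compression[OF X bound]) (rule that)
    have Yw: "Y i $$ (q, r) = (\<Sum>p<?d * n. cnj (w p q) * complex_of_real (x p $ i) * w p r)"
      if "q < n" "r < n" for i q r
    proof -
      have "X i \<in> carrier_mat n n" using X by (simp add: sa_tuples_def)
      then have "Y i $$ (q, r) = complex_of_real (1 / ?d) * X i $$ (q, r)"
        using that by (simp add: Y_def)
      then show ?thesis using Xw[OF that] by simp
    qed
    have d: "real ?d \<noteq> 0" "?d * n \<ge> 1" using n by (simp_all add: Suc_le_eq)
    have "Y \<in> Wmin_level (diamond :: (real^'d) set) n"
      by (rule diag_compression_mem_Wmin_level[OF Y w x Yw])
    then have "Y \<in> Wmin (diamond :: (real^'d) set)" using n by (auto simp: Wmin_def)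
    moreover have "Y \<in> \<S>" if "matrix_convex \<S>" "(diamond :: (real^'d) set) \<subseteq> level_one \<S>" for \<S>
    proof (rule diag_compression_mem_matrix_convex[OF that(1) n d(2) Y w _ Yw])
      show "x p \<in> level_one \<S>" if "p < ?d * n" for p using x[OF that] \<open>diamond \<subseteq> level_one \<S>\<close> by blast
    qed
    ultimately show ?thesis using mem_scale_tuples[OF d(1)] unfolding Y_def by blast
  qed
  then show ?thesis unfolding matrix_cube_eq_Wmax by blast
qed

end
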